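(* Let $D$ be an integral domain in the class $\mathcal{C}$. For each prime power $q$ let $\pi_q$ be a generator of $\Pi_q$ and let $F_q=\frac{X^q-X}{\pi_q}\in\operatorname{Int}(D)$. Let $\mathbf{X}=\{X_i\}_{i\in I}$ be a set of variables. The unique $D$-algebra homomorphism $$D[\{X_i, X_{i,q,k}: i\in I,\ q\text{ is a prime power, and }k\in\mathbb{Z}_{\ge 0}\}]\longrightarrow\operatorname{Int}(D^{\mathbf{X}}),\qquad X_i\longmapsto X_i,\quad X_{i,q,k}\longmapsto F_q^{\circ k}(X_i),$$ is surjective, and its kernel is equal to the ideal generated by $X_{i,q,0}-X_i$ and $X_{i,q,k}^q-X_{i,q,k}-\pi_qX_{i,q,k+1}$ for all $i,q,k$.
   Context: Let $D$ be an integral domain with quotient field $K$. $\operatorname{Int}(D)=\{f\in K[X]: f(D)\subseteq D\}$, and for a set $\mathbf{X}$ of variables, $\operatorname{Int}(D^{\mathbf{X}})=\{f\in K[\mathbf{X}]: f(D^{\mathbf{X}})\subseteq D\}$. For a polynomial $f$ in one variable, $f^{\circ k}$ is the $k$-fold composition of $f$ with itself, with $f^{\circ 0}=X$. For a nonzero fractional ideal $I$ of $D$, $I^{-1}=\{x\in K: xI\subseteq D\}$, $I_v=(I^{-1})^{-1}$, and $I_t=\bigcup J_v$ over the nonzero finitely generated $J\subseteq I$; $I$ is a $t$-ideal if $I_t=I$. A $t$-maximal ideal of $D$ is an ideal maximal among the nonzero proper ideals of $D$ that are $t$-ideals. The norm of an ideal $\mathfrak{a}$ is $N(\mathfrak{a})=|D/\mathfrak{a}|$.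 $\Pi_q=\Pi_q(D)$ is the intersection of all $t$-maximal ideals of $D$ of norm $q$ (equal to $D$ if there are none). $D$ is polynomially L-regular if $S^{-1}\operatorname{Int}(D)=\operatorname{Int}(S^{-1}D)$ for every multiplicative subset $S$ of $D$ (with $0\notin S$). The class $\mathcal{C}$ consists of the integral domains $D$ such that: ($\mathcal{C}1$) $D$ is polynomially L-regular; ($\mathcal{C}2$) for any nonnegative integer $n$ there exist only finitely many $t$-maximal ideals $\mathfrak{p}$ of $D$ with $N(\mathfrak{p})\le n$; ($\mathcal{C}3$) $\Pi_q$ is principal for every prime power $q$; ($\mathcal{C}4$) every $t$-maximal ideal of $D$ of finite norm has finite height. *)

theory Defs
  imports
    "HOL-Algebra.Algebraic_Closure_Type"
    "HOL-Library.Poly_Mapping"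
    "HOL-Library.Extended_Nat"
    "HOL-Number_Theory.Prime_Powers"
begin

text \<open>
  The quotient field \<open>K\<close> is a type of class \<^class>\<open>field\<close>, and the domain \<open>D\<close> is a subring of it,
  so that the localizations of \<open>D\<close> are subrings of the same field. For the ring-theoretic notions
  of HOL-Algebra, a subset of a type-class ring is viewed as a ring record.
\<close>

definition ring_on :: "'r::ring_1 set \<Rightarrow> 'r ring" where
  "ring_on A = ring_of_type_algebra\<lparr>carrier := A\<rparr>"

definition domain_with_quotient_field :: "'k::field set \<Rightarrow> bool" where
  "domain_with_quotient_field D \<longleftrightarrow>
     subdomain D ring_of_type_algebra \<and> (\<forall>x. \<exists>a\<in>D. \<exists>b\<in>D. b \<noteq> 0 \<and> x = a / b)"


section \<open>Ideals\<close>

definition frac_inverse :: "'k::field set \<Rightarrow> 'k set \<Rightarrow> 'k set" where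
  "frac_inverse D I = {x. \<forall>y\<in>I. x * y \<in> D}"

definition v_closure :: "'k::field set \<Rightarrow> 'k set \<Rightarrow> 'k set" where
  "v_closure D I = frac_inverse D (frac_inverse D I)"

definition generated_frac_ideal :: "'k::field set \<Rightarrow> 'k set \<Rightarrow> 'k set" where
  "generated_frac_ideal D A = {\<Sum>a\<in>A. c a * a | c. c \<in> A \<rightarrow> D}"

definition t_closure :: "'k::field set \<Rightarrow> 'k set \<Rightarrow> 'k set" where
  "t_closure D I =
     \<Union> {v_closure D J | J. (\<exists>A. finite A \<and> J = generated_frac_ideal D A) \<and> J \<noteq> {0} \<and> J \<subseteq> I}"

text \<open>Every ideal of \<open>D\<close> is a fractional ideal, so \<open>t_closure\<close> applies to it directly.\<close>

definition proper_t_ideal :: "'k::field set \<Rightarrow> 'k set \<Rightarrow> bool" where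
  "proper_t_ideal D I \<longleftrightarrow> ideal I (ring_on D) \<and> I \<noteq> {0} \<and> I \<noteq> D \<and> t_closure D I = I"

definition t_maximal :: "'k::field set \<Rightarrow> 'k set \<Rightarrow> bool" where
  "t_maximal D \<pp> \<longleftrightarrow>
     proper_t_ideal D \<pp> \<and> (\<forall>J. proper_t_ideal D J \<and> \<pp> \<subseteq> J \<longrightarrow> J = \<pp>)"

definition ideal_norm :: "'k::field set \<Rightarrow> 'k set \<Rightarrow> enat" where
  "ideal_norm D I =
     (if finite (carrier (ring_on D Quot I)) then enat (card (carrier (ring_on D Quot I))) else \<infinity>)"

text \<open>Lengths of chains of primes ending in \<open>\<pp>\<close>; meant for prime \<open>\<pp>\<close>, and \<open>t\<close>-maximal ideals are prime.\<close>

definition height :: "'k::field set \<Rightarrow> 'k set \<Rightarrow> enat" where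
  "height D \<pp> =
     (SUP n \<in> {n. \<exists>P :: nat \<Rightarrow> 'k set. (\<forall>i\<le>n. primeideal (P i) (ring_on D)) \<and>
                    (\<forall>i<n. P i \<subset> P (Suc i)) \<and> P n = \<pp>}. enat n)"

text \<open>Intersecting with \<open>D\<close> makes the value \<open>D\<close> when there is no \<open>t\<close>-maximal ideal of norm \<open>q\<close>.\<close>

definition Pi_ideal :: "'k::field set \<Rightarrow> nat \<Rightarrow> 'k set" where
  "Pi_ideal D q = D \<inter> \<Inter> {\<pp>. t_maximal D \<pp> \<and> ideal_norm D \<pp> = enat q}"


section \<open>Integer-valued polynomials in one variable and the class \<open>\<C>\<close>\<close>

definition int_valued :: "'k::field set \<Rightarrow> 'k poly set" where
  "int_valued D = {f. \<forall>x\<in>D. poly f x \<in> D}"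

definition mult_subset :: "'k::field set \<Rightarrow> 'k set \<Rightarrow> bool" where
  "mult_subset D S \<longleftrightarrow> submonoid S (ring_on D) \<and> 0 \<notin> S"

definition localize :: "'k::field set \<Rightarrow> 'k set \<Rightarrow> 'k set" where
  "localize S D = {a / s | a s. a \<in> D \<and> s \<in> S}"

definition localize_poly :: "'k::field set \<Rightarrow> 'k poly set \<Rightarrow> 'k poly set" where
  "localize_poly S A = {smult (1 / s) f | f s. f \<in> A \<and> s \<in> S}"

definition poly_L_regular :: "'k::field set \<Rightarrow> bool" where
  "poly_L_regular D \<longleftrightarrow>
     (\<forall>S. mult_subset D S \<longrightarrow> localize_poly S (int_valued D) = int_valued (localize S D))"

definition class_C :: "'k::field set \<Rightarrow> bool" where
  "class_C D \<longleftrightarrow>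
     domain_with_quotient_field D \<and>
     poly_L_regular D \<and>
     (\<forall>n::nat. finite {\<pp>. t_maximal D \<pp> \<and> ideal_norm D \<pp> \<le> enat n}) \<and>
     (\<forall>q. primepow q \<longrightarrow> principalideal (Pi_ideal D q) (ring_on D)) \<and>
     (\<forall>\<pp>. t_maximal D \<pp> \<and> ideal_norm D \<pp> < \<infinity> \<longrightarrow> height D \<pp> < \<infinity>)"


section \<open>Polynomials in a set of variables\<close>

type_synonym ('v, 'k) mpol = "('v \<Rightarrow>\<^sub>0 nat) \<Rightarrow>\<^sub>0 'k"

definition mconst :: "'k::zero \<Rightarrow> ('v, 'k) mpol" where
  "mconst c = Poly_Mapping.single 0 c"

definition mvar :: "'v \<Rightarrow> ('v, 'k::zero_neq_one) mpol" where
  "mvar v = Poly_Mapping.single (Poly_Mapping.single v 1) 1"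

definition mvars :: "('v, 'k::zero) mpol \<Rightarrow> 'v set" where
  "mvars f = (\<Union>m\<in>Poly_Mapping.keys f. Poly_Mapping.keys m)"

definition meval :: "('v \<Rightarrow> 'k::comm_semiring_1) \<Rightarrow> ('v, 'k) mpol \<Rightarrow> 'k" where
  "meval x f = (\<Sum>m\<in>Poly_Mapping.keys f.
     Poly_Mapping.lookup f m * (\<Prod>v\<in>Poly_Mapping.keys m. x v ^ Poly_Mapping.lookup m v))"

definition mpol_ring :: "'k::field set \<Rightarrow> 'v set \<Rightarrow> ('v, 'k) mpol ring" where
  "mpol_ring D V = ring_on {f. (\<forall>m. Poly_Mapping.lookup f m \<in> D) \<and> mvars f \<subseteq> V}"

definition int_valued_ring :: "'k::field set \<Rightarrow> 'i set \<Rightarrow> ('i, 'k) mpol ring" where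
  "int_valued_ring D I = ring_on {f. mvars f \<subseteq> I \<and> (\<forall>x \<in> I \<rightarrow> D. meval x f \<in> D)}"

text \<open>The element \<open>f(X\<^sub>v)\<close> for a polynomial \<open>f\<close> in one variable.\<close>

definition poly_at_var :: "'k::field poly \<Rightarrow> 'v \<Rightarrow> ('v, 'k) mpol" where
  "poly_at_var f v = poly (map_poly mconst f) (mvar v)"

definition D_algebra_hom ::
    "'k::field set \<Rightarrow> ('v, 'k) mpol ring \<Rightarrow> ('w, 'k) mpol ring \<Rightarrow> (('v, 'k) mpol \<Rightarrow> ('w, 'k) mpol) \<Rightarrow> bool" where
  "D_algebra_hom D A B \<phi> \<longleftrightarrow> \<phi> \<in> ring_hom A B \<and> (\<forall>d\<in>D. \<phi> (mconst d) = mconst d)"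


section \<open>The presentation\<close>

definition F_poly :: "(nat \<Rightarrow> 'k::field) \<Rightarrow> nat \<Rightarrow> 'k poly" where
  "F_poly \<pi> q = smult (1 / \<pi> q) ([:0, 1:] ^ q - [:0, 1:])"

definition poly_iterate :: "nat \<Rightarrow> 'k::field poly \<Rightarrow> 'k poly" where
  "poly_iterate k f = (pcompose f ^^ k) [:0, 1:]"

text \<open>\<open>Base i\<close> and \<open>Iter i q k\<close> index the variables \<open>X\<^sub>i\<close> and \<open>X\<^bsub>i,q,k\<^esub>\<close>.\<close>

datatype 'i gen_var = Base 'i | Iter 'i nat nat

definition gen_vars :: "'i set \<Rightarrow> 'i gen_var set" where
  "gen_vars I = {Base i | i. i \<in> I} \<union> {Iter i q k | i q k. i \<in> I \<and> primepow q}"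

definition relators :: "(nat \<Rightarrow> 'k::field) \<Rightarrow> 'i set \<Rightarrow> ('i gen_var, 'k) mpol set" where
  "relators \<pi> I =
     {mvar (Iter i q 0) - mvar (Base i) | i q. i \<in> I \<and> primepow q} \<union>
     {mvar (Iter i q k) ^ q - mvar (Iter i q k) - mconst (\<pi> q) * mvar (Iter i q (Suc k))
        | i q k. i \<in> I \<and> primepow q}"

end

theory Submission
  imports Defs "HOL-Algebra.Sylow"
begin

text \<open>
  For \<open>f \<in> Int(D)\<close> of degree at most \<open>n\<close>, the coefficient of \<open>X\<^sup>n\<close> is a divided difference of \<open>f\<close> at
  \<open>n + 1\<close> points of \<open>D\<close>. If the points are chosen with pairwise distinct residues or, at a
  \<open>t\<close>-maximal ideal of norm \<open>q \<le> n\<close>, as expansions in powers of \<open>\<pi>\<^sub>q\<close> with digits representing the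
  residue field, this bounds the denominator locally; as \<open>D\<close> is the intersection of its
  localizations at \<open>t\<close>-maximal ideals, the coefficient lies in the inverse of the product of the
  \<open>\<pi>\<^sub>q\<close>, each raised to the sum of the \<open>\<lfloor>n / q\<^sup>j\<rfloor>\<close> over \<open>j \<ge> 1\<close>. Products of the iterates \<open>F\<^sub>q\<^sup>\<circ>\<^sup>k\<close> along the
  base \<open>q\<close> digits of \<open>n\<close> attain the \<open>q\<close>-part of this bound, and the \<open>\<pi>\<^sub>q\<close> are pairwise comaximal,
  so the image of the homomorphism contains elements with the extremal leading coefficient in every
  degree. Surjectivity follows by subtracting top terms, one variable at a time.

  For the kernel, multiply an element by \<open>\<pi>\<^sub>r\<close>'s with \<open>r \<noteq> q\<close> to eliminate all \<open>X\<^bsub>i,r,k\<^esub>\<close> modulo the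
  relations. What remains reduces to a combination of the digit products for \<open>q\<close>, whose images have
  different leading monomials and hence are linearly independent. So every \<open>q\<close> yields a multiplier
  that moves the element into the ideal of relations, and by comaximality these multipliers
  generate the unit ideal of \<open>D\<close>.
\<close>

section \<open>Ideals and \<open>t\<close>-ideals\<close>

text \<open>Subrings are described through the type-class operations, so that one locale serves
  \<open>D\<close>, the polynomial ring over \<open>D\<close> and the ring of integer-valued
  polynomials.\<close>

locale type_subring =
  fixes S :: "'r::comm_ring_1 set"
  assumes one_closed: "1 \<in> S"
    and add_closed: "\<And>x y. x \<in> S \<Longrightarrow> y \<in> S \<Longrightarrow> x + y \<in> S"
    and mult_closed: "\<And>x y. x \<in> S \<Longrightarrow> y \<in> S \<Longrightarrow> x * y \<in> S"
    and uminus_closed: "\<And>x. x \<in> S \<Longrightarrow> - x \<in> S"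
begin

lemma zero_closed: "0 \<in> S"
  using add_closed[OF one_closed uminus_closed[OF one_closed]] by simp

lemma diff_closed: "x \<in> S \<Longrightarrow> y \<in> S \<Longrightarrow> x - y \<in> S"
  using add_closed[OF _ uminus_closed] by fastforce

lemma power_closed: "x \<in> S \<Longrightarrow> x ^ n \<in> S"
  by (induction n) (auto intro: one_closed mult_closed)

lemma prod_closed: "(\<And>a. a \<in> A \<Longrightarrow> f a \<in> S) \<Longrightarrow> prod f A \<in> S"
  by (induction A rule: infinite_finite_induct) (auto intro: one_closed mult_closed)

lemma sum_closed: "(\<And>a. a \<in> A \<Longrightarrow> f a \<in> S) \<Longrightarrow> sum f A \<in> S"
  by (induction A rule: infinite_finite_induct) (auto intro: zero_closed add_closed)

lemmas closed = zero_closed one_closed add_closed mult_closed uminus_closed diff_closed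
  power_closed prod_closed sum_closed

lemma cring_ring_on: "cring (ring_on S)"
proof (rule cringI)
  show "abelian_group (ring_on S)"
    by (rule abelian_groupI)
      (auto simp: ring_on_def ring_of_type_algebra_def algebra_simps
        intro: closed bexI[of _ "- x" for x])
  show "Group.comm_monoid (ring_on S)"
    by (rule comm_monoidI)
      (simp_all add: ring_on_def ring_of_type_algebra_def mult.assoc mult.commute one_closed mult_closed)
qed (simp add: ring_on_def ring_of_type_algebra_def distrib_right)

text \<open>Elementwise form of the record-based notion, used in its place below. Closure under
  negation comes from multiplication by \<open>- 1\<close>.\<close>

lemma ideal_iff:
  "ideal I (ring_on S) \<longleftrightarrow>
     I \<subseteq> S \<and> 0 \<in> I \<and> (\<forall>x\<in>I. \<forall>y\<in>I. x + y \<in> I) \<and> (\<forall>x\<in>S. \<forall>y\<in>I. x * y \<in> I)"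
proof
  assume "ideal I (ring_on S)"
  then interpret ideal I "ring_on S" .
  show "I \<subseteq> S \<and> 0 \<in> I \<and> (\<forall>x\<in>I. \<forall>y\<in>I. x + y \<in> I) \<and> (\<forall>x\<in>S. \<forall>y\<in>I. x * y \<in> I)"
    using a_subset I_l_closed additive_subgroup.zero_closed[OF additive_subgroup_axioms]
      additive_subgroup.a_closed[OF additive_subgroup_axioms]
    unfolding ring_on_def ring_of_type_algebra_def by (simp add: subset_iff)
next
  assume I: "I \<subseteq> S \<and> 0 \<in> I \<and> (\<forall>x\<in>I. \<forall>y\<in>I. x + y \<in> I) \<and> (\<forall>x\<in>S. \<forall>y\<in>I. x * y \<in> I)"
  interpret R: cring "ring_on S" by (rule cring_ring_on)
  have inv: "\<ominus>\<^bsub>ring_on S\<^esub> x = - x" if "x \<in> S" for x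
    by (rule R.minus_equality)
      (use that uminus_closed in \<open>auto simp: ring_on_def ring_of_type_algebra_def\<close>)
  show "ideal I (ring_on S)"
  proof (rule idealI)
    show "subgroup I (add_monoid (ring_on S))"
    proof (rule group.subgroupI[OF R.a_group])
      fix a assume a: "a \<in> I"
      have "- 1 * a \<in> I" using I a uminus_closed one_closed by blast
      with a I inv[of a] show "inv\<^bsub>add_monoid (ring_on S)\<^esub> a \<in> I"
        by (auto simp: a_inv_def)
    qed (use I in \<open>auto simp: ring_on_def ring_of_type_algebra_def\<close>)
  next
    show "ring (ring_on S)" by (rule R.ring_axioms)
    fix a x assume "a \<in> I" "x \<in> carrier (ring_on S)"
    then have "x * a \<in> I" using I by (auto simp: ring_on_def)
    then show "x \<otimes>\<^bsub>ring_on S\<^esub> a \<in> I" "a \<otimes>\<^bsub>ring_on S\<^esub> x \<in> I"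
      by (simp_all add: ring_on_def ring_of_type_algebra_def mult.commute)
  qed
qed

end

lemma ring_on_simps [simp]:
  "carrier (ring_on S) = S" "\<one>\<^bsub>ring_on S\<^esub> = 1" "\<zero>\<^bsub>ring_on S\<^esub> = 0"
  "x \<otimes>\<^bsub>ring_on S\<^esub> y = x * y" "x \<oplus>\<^bsub>ring_on S\<^esub> y = x + y"
  by (auto simp: ring_on_def ring_of_type_algebra_def)

lemma mem_generated_frac_ideal:
  assumes "0 \<in> D" "1 \<in> D" "finite A" "a \<in> A"
  shows "a \<in> generated_frac_ideal D A"
proof -
  have "(\<Sum>b\<in>A. (if b = a then 1 else 0) * b) = (\<Sum>b\<in>A. if b = a then b else 0)"
    by (rule sum.cong) auto
  also have "\<dots> = a" using assms by simp
  finally show ?thesis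
    unfolding generated_frac_ideal_def using assms
    by (intro CollectI exI[of _ "\<lambda>b. if b = a then 1 else 0"]) auto
qed

lemma generated_frac_ideal_subset_iff:
  assumes "type_subring D" "ideal I (ring_on D)" "finite A"
  shows "generated_frac_ideal D A \<subseteq> I \<longleftrightarrow> A \<subseteq> I"
proof -
  interpret type_subring D by fact
  note I = assms(2)[unfolded ideal_iff]
  have "(\<Sum>b\<in>B. c b * b) \<in> I" if "c \<in> B \<rightarrow> D" "B \<subseteq> I" for B c
    using that by (induction B rule: infinite_finite_induct) (use I in \<open>auto simp: Pi_def\<close>)
  then show ?thesis
    using mem_generated_frac_ideal[OF zero_closed one_closed assms(3)]
    by (auto simp: generated_frac_ideal_def subset_iff)
qed

section \<open>The \<open>t\<close>-closure and \<open>t\<close>-maximal ideals of a domain inside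
  its quotient field\<close>

locale quotient_field_domain =
  fixes D :: "'k::field set"
  assumes domain_with_quotient_field: "domain_with_quotient_field D"
begin

sublocale type_subring D
proof -
  have "subdomain D (ring_of_type_algebra :: 'k ring)"
    using domain_with_quotient_field by (simp add: domain_with_quotient_field_def)
  then have sub: "subring D (ring_of_type_algebra :: 'k ring)"
    by (simp add: subdomain.axioms(1) subcring.axioms(1) subdomain_def)
  interpret R: ring "ring_of_type_algebra :: 'k ring" by (rule ring_from_type_algebra)
  have "x \<in> D \<Longrightarrow> \<ominus>\<^bsub>ring_of_type_algebra\<^esub> x = - x" for x
    by (rule R.minus_equality) (auto simp: ring_of_type_algebra_def)
  then show "type_subring D"
    using subringE(3,5-7)[OF sub] by unfold_locales (simp_all add: ring_of_type_algebra_def)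
qed

lemma fraction: "\<exists>a\<in>D. \<exists>b\<in>D. b \<noteq> 0 \<and> x = a / b"
  using domain_with_quotient_field by (auto simp: domain_with_quotient_field_def)

lemma t_closure_superset:
  assumes "ideal I (ring_on D)" "I \<noteq> {0}"
  shows "I \<subseteq> t_closure D I"
proof
  fix y assume "y \<in> I"
  note I = assms(1)[unfolded ideal_iff]
  from I have "0 \<in> I" by blast
  \<comment> \<open>The second generator \<open>z\<close> keeps the finitely generated ideal nonzero
    even when \<open>y = 0\<close>.\<close>
  then obtain z where z: "z \<in> I" "z \<noteq> 0" using assms(2) by blast
  let ?J = "generated_frac_ideal D {y, z}"
  have sub: "?J \<subseteq> I"
    using generated_frac_ideal_subset_iff[OF type_subring_axioms assms(1), of "{y, z}"] \<open>y \<in> I\<close> z by simp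
  have mem: "a \<in> ?J" if "a \<in> {y, z}" for a
    by (rule mem_generated_frac_ideal) (use that zero_closed one_closed in auto)
  have "y \<in> ?J" "z \<in> ?J" by (auto intro: mem)
  then have "y \<in> v_closure D ?J" "?J \<noteq> {0}"
    using z(2) unfolding v_closure_def frac_inverse_def by (auto simp: mult.commute)
  moreover have "finite {y, z}" by simp
  ultimately show "y \<in> t_closure D I"
    unfolding t_closure_def using sub by (intro UnionI[of "v_closure D ?J"]) blast+
qed

lemma t_closure_subsetI:
  assumes "\<And>A x. finite A \<Longrightarrow> A \<subseteq> I \<Longrightarrow> generated_frac_ideal D A \<subseteq> I \<Longrightarrow>
      generated_frac_ideal D A \<noteq> {0} \<Longrightarrow> x \<in> v_closure D (generated_frac_ideal D A) \<Longrightarrow> x \<in> I"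
    and "ideal I (ring_on D)"
  shows "t_closure D I \<subseteq> I"
proof
  fix x assume "x \<in> t_closure D I"
  then obtain A where A: "finite A" "generated_frac_ideal D A \<noteq> {0}"
      "generated_frac_ideal D A \<subseteq> I" "x \<in> v_closure D (generated_frac_ideal D A)"
    unfolding t_closure_def by auto
  then have "A \<subseteq> I"
    using generated_frac_ideal_subset_iff[OF type_subring_axioms assms(2)] by blast
  with A show "x \<in> I" using assms(1) by blast
qed

lemma v_closure_subset_t_closure:
  assumes "finite A" "generated_frac_ideal D A \<subseteq> I" "generated_frac_ideal D A \<noteq> {0}"
  shows "v_closure D (generated_frac_ideal D A) \<subseteq> t_closure D I"
  using assms unfolding t_closure_def by blast

lemma v_closure_mult_mem: "x \<in> v_closure D J \<Longrightarrow> (\<And>y. y \<in> J \<Longrightarrow> c * y \<in> D) \<Longrightarrow> c * x \<in> D"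
  unfolding v_closure_def frac_inverse_def by (auto simp: mult.commute)

lemma v_closure_subset_domain: "J \<subseteq> D \<Longrightarrow> v_closure D J \<subseteq> D"
  using v_closure_mult_mem[of _ J 1] by (simp add: subset_iff)

lemma proper_t_ideal_iff:
  "proper_t_ideal D I \<longleftrightarrow> ideal I (ring_on D) \<and> I \<noteq> {0} \<and> 1 \<notin> I \<and> t_closure D I \<subseteq> I"
proof -
  have "1 \<in> I \<longleftrightarrow> I = D" if "ideal I (ring_on D)"
  proof
    assume "1 \<in> I"
    with that[unfolded ideal_iff] show "I = D" by (metis mult_1_right subset_antisym subset_iff)
  qed (use one_closed in auto)
  with t_closure_superset[of I] show ?thesis
    unfolding proper_t_ideal_def by blast
qed

text \<open>Zorn's lemma applies because the \<open>t\<close>-closure has finite character: finitely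
  many generators in the union of a chain already lie in one member of the chain.\<close>

lemma t_maximal_exists:
  assumes "proper_t_ideal D I"
  shows "\<exists>\<pp>. t_maximal D \<pp> \<and> I \<subseteq> \<pp>"
proof -
  let ?P = "{J. proper_t_ideal D J \<and> I \<subseteq> J}"
  have "\<exists>M\<in>?P. \<forall>J\<in>?P. M \<subseteq> J \<longrightarrow> J = M"
  proof (rule subset_Zorn_nonempty)
    show "?P \<noteq> {}" using assms by auto
    fix C assume C: "C \<noteq> {}" "subset.chain ?P C"
    let ?U = "\<Union>C"
    have mem: "proper_t_ideal D J" "I \<subseteq> J" if "J \<in> C" for J
      using C that by (auto simp: subset.chain_def)
    then have id: "J \<subseteq> D" "0 \<in> J" "x \<in> J \<Longrightarrow> y \<in> J \<Longrightarrow> x + y \<in> J"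
        "z \<in> D \<Longrightarrow> x \<in> J \<Longrightarrow> z * x \<in> J" "1 \<notin> J" if "J \<in> C" for J x y z
      using that unfolding proper_t_ideal_iff ideal_iff by blast+
    obtain J0 where J0: "J0 \<in> C" using C(1) by blast
    have "ideal ?U (ring_on D)"
      unfolding ideal_iff
    proof (intro conjI ballI)
      show "?U \<subseteq> D" using id(1) by (rule Union_least)
      show "0 \<in> ?U" using id(2)[OF J0] J0 by (rule UnionI[rotated])
      fix x y assume "x \<in> ?U" "y \<in> ?U"
      then obtain J1 J2 where J: "x \<in> J1" "J1 \<in> C" "y \<in> J2" "J2 \<in> C" by blast
      then consider "J1 \<subseteq> J2" | "J2 \<subseteq> J1"
        using subset.chain_total[OF C(2) J(2,4)] by blast
      then show "x + y \<in> ?U"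
      proof cases
        case 1
        then show ?thesis using id(3)[OF J(4), of x y] J by (intro UnionI[of J2]) auto
      next
        case 2
        then show ?thesis using id(3)[OF J(2), of x y] J by (intro UnionI[of J1]) auto
      qed
    next
      fix x y assume "x \<in> D" "y \<in> ?U"
      then show "x * y \<in> ?U" using id(4) by blast
    qed
    moreover have "?U \<noteq> {0}"
    proof -
      have "0 \<in> I" "I \<noteq> {0}" using assms by (auto simp: proper_t_ideal_iff ideal_iff)
      then obtain x where "x \<in> I" "x \<noteq> 0" by blast
      then show ?thesis using mem(2)[OF J0] J0 by blast
    qed
    moreover have "1 \<notin> ?U" using id(5) by blast
    moreover have "t_closure D ?U \<subseteq> ?U"
    proof (rule t_closure_subsetI[OF _ \<open>ideal ?U (ring_on D)\<close>])
      fix A x assume A: "finite A" "A \<subseteq> ?U" "generated_frac_ideal D A \<noteq> {0}"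
        "x \<in> v_closure D (generated_frac_ideal D A)"
      from finite_subset_Union_chain[OF A(1,2) C] obtain J where J: "J \<in> C" "A \<subseteq> J" .
      have "ideal J (ring_on D)" using mem J(1) by (auto simp: proper_t_ideal_iff)
      then have "generated_frac_ideal D A \<subseteq> J"
        using generated_frac_ideal_subset_iff[OF type_subring_axioms _ A(1)] J by blast
      then have "x \<in> t_closure D J" using v_closure_subset_t_closure A by blast
      then show "x \<in> ?U" using mem(1)[OF J(1)] J(1) by (auto simp: proper_t_ideal_iff)
    qed
    moreover have "I \<subseteq> ?U" using mem(2)[OF J0] J0 by blast
    moreover note \<open>ideal ?U (ring_on D)\<close>
    ultimately show "?U \<in> ?P" by (simp add: proper_t_ideal_iff)
  qed
  then show ?thesis unfolding t_maximal_def by (metis (mono_tags, lifting) dual_order.trans mem_Collect_eq)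
qed

text \<open>The conductor \<open>D :\<^sub>D c\<close> is a \<open>t\<close>-ideal, so if it is proper it lies in some \<open>t\<close>-maximal ideal.\<close>

lemma mem_if_locally_mem:
  assumes "\<And>\<pp>. t_maximal D \<pp> \<Longrightarrow> \<exists>s\<in>D - \<pp>. s * c \<in> D"
  shows "c \<in> D"
proof (rule ccontr)
  assume c: "c \<notin> D"
  define I where "I = {d\<in>D. d * c \<in> D}"
  have id: "ideal I (ring_on D)"
    unfolding ideal_iff I_def by (auto simp: algebra_simps intro: closed)
  have "proper_t_ideal D I"
    unfolding proper_t_ideal_iff
  proof (intro conjI id t_closure_subsetI)
    obtain a b where "a \<in> D" "b \<in> D" "b \<noteq> 0" "c = a / b" using fraction by blast
    then have "b \<in> I" by (auto simp: I_def)
    with \<open>b \<noteq> 0\<close> show "I \<noteq> {0}" by blast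
    show "1 \<notin> I" using c by (auto simp: I_def)
    fix A x assume A: "finite A" "generated_frac_ideal D A \<subseteq> I"
      "x \<in> v_closure D (generated_frac_ideal D A)"
    \<comment> \<open>\<open>c\<close> multiplies the finitely generated ideal into
      \<open>D\<close>, hence it also multiplies the \<open>v\<close>-closure of that ideal into
      \<open>D\<close>.\<close>
    have "c * x \<in> D"
      by (rule v_closure_mult_mem[OF A(3)]) (use A(2) in \<open>auto simp: I_def mult.commute\<close>)
    moreover have "x \<in> D"
      using v_closure_subset_domain A(2,3) by (auto simp: I_def)
    ultimately show "x \<in> I" by (auto simp: I_def mult.commute)
  qed
  then obtain \<pp> where "t_maximal D \<pp>" "I \<subseteq> \<pp>" using t_maximal_exists by blast
  with assms[of \<pp>] show False by (auto simp: I_def)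
qed

lemma t_maximal_ideal: "t_maximal D \<pp> \<Longrightarrow> ideal \<pp> (ring_on D)"
  and t_maximal_one: "t_maximal D \<pp> \<Longrightarrow> 1 \<notin> \<pp>"
  and t_maximal_nonzero: "t_maximal D \<pp> \<Longrightarrow> \<exists>x\<in>\<pp>. x \<noteq> 0"
  unfolding t_maximal_def proper_t_ideal_iff ideal_iff by blast+

text \<open>If \<open>a \<notin> \<pp>\<close>, then \<open>\<pp> :\<^sub>D a\<close> is again a proper \<open>t\<close>-ideal, so it equals \<open>\<pp>\<close>.\<close>

lemma t_maximal_prime:
  assumes \<pp>: "t_maximal D \<pp>" and a: "a \<in> D" "a \<notin> \<pp>" and b: "b \<in> D" "a * b \<in> \<pp>"
  shows "b \<in> \<pp>"
proof -
  note id = t_maximal_ideal[OF \<pp>, unfolded ideal_iff]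
  define I where "I = {d\<in>D. a * d \<in> \<pp>}"
  have idI: "ideal I (ring_on D)"
    unfolding ideal_iff
  proof (intro conjI ballI)
    fix x y assume "x \<in> D" "y \<in> I"
    then have "x * (a * y) \<in> \<pp>" "x * y \<in> D" using id by (auto simp: I_def intro: closed)
    then show "x * y \<in> I" by (simp add: I_def mult.left_commute)
  qed (use id in \<open>auto simp: I_def distrib_left intro: closed\<close>)
  have sub: "\<pp> \<subseteq> I" using id a by (auto simp: I_def)
  have "proper_t_ideal D I"
    unfolding proper_t_ideal_iff
  proof (intro conjI idI t_closure_subsetI)
    show "I \<noteq> {0}" using t_maximal_nonzero[OF \<pp>] sub by blast
    show "1 \<notin> I" using a by (auto simp: I_def)
    fix A x assume A: "finite A" "A \<subseteq> I" "generated_frac_ideal D A \<subseteq> I"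
      "generated_frac_ideal D A \<noteq> {0}" "x \<in> v_closure D (generated_frac_ideal D A)"
    have "a \<noteq> 0" using a id by auto
    have "inj_on ((*) a) A" using \<open>a \<noteq> 0\<close> by (auto simp: inj_on_def)
    \<comment> \<open>Scaling by \<open>a\<close> is compatible with generating an ideal and with
      the \<open>v\<close>-closure. Since the scaled ideal lies in \<open>\<pp>\<close>, so does
      \<open>a * x\<close>, because \<open>\<pp>\<close> is a \<open>t\<close>-ideal.\<close>
    have gen: "generated_frac_ideal D ((*) a ` A) = (*) a ` generated_frac_ideal D A"
    proof (intro equalityI subsetI)
      fix y assume "y \<in> generated_frac_ideal D ((*) a ` A)"
      then obtain c where c: "c \<in> (*) a ` A \<rightarrow> D" "y = (\<Sum>e\<in>(*) a ` A. c e * e)"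
        by (auto simp: generated_frac_ideal_def)
      have "y = a * (\<Sum>e\<in>A. c (a * e) * e)"
        unfolding c(2)
        by (simp add: sum.reindex[OF \<open>inj_on ((*) a) A\<close>] sum_distrib_left mult.left_commute)
      moreover have "(\<lambda>e. c (a * e)) \<in> A \<rightarrow> D" using c by auto
      then have "(\<Sum>e\<in>A. c (a * e) * e) \<in> generated_frac_ideal D A"
        unfolding generated_frac_ideal_def by (intro CollectI exI[of _ "\<lambda>e. c (a * e)"]) simp
      ultimately show "y \<in> (*) a ` generated_frac_ideal D A" by blast
    next
      fix y assume "y \<in> (*) a ` generated_frac_ideal D A"
      then obtain c where c: "c \<in> A \<rightarrow> D" "y = a * (\<Sum>e\<in>A. c e * e)"
        by (auto simp: generated_frac_ideal_def)
      have "y = (\<Sum>e\<in>(*) a ` A. c (e / a) * e)"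
        unfolding c(2) using \<open>a \<noteq> 0\<close>
        by (simp add: sum.reindex[OF \<open>inj_on ((*) a) A\<close>] sum_distrib_left mult.left_commute)
      moreover have "(\<lambda>e. c (e / a)) \<in> (*) a ` A \<rightarrow> D" using c \<open>a \<noteq> 0\<close> by auto
      ultimately show "y \<in> generated_frac_ideal D ((*) a ` A)"
        unfolding generated_frac_ideal_def by (intro CollectI exI[of _ "\<lambda>e. c (e / a)"]) simp
    qed
    have "a * x \<in> v_closure D ((*) a ` generated_frac_ideal D A)"
      unfolding v_closure_def frac_inverse_def
    proof (intro CollectI ballI)
      fix z assume "z \<in> {z. \<forall>y\<in>(*) a ` generated_frac_ideal D A. z * y \<in> D}"
      then have "(z * a) * x \<in> D"
        by (intro v_closure_mult_mem[OF A(5)]) (auto simp: mult.assoc)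
      then show "a * x * z \<in> D" by (simp add: mult_ac)
    qed
    moreover have "(*) a ` generated_frac_ideal D A \<subseteq> \<pp>"
      using A(3) by (auto simp: I_def)
    moreover have "(*) a ` generated_frac_ideal D A \<noteq> {0}"
      using A(4) \<open>a \<noteq> 0\<close> inj_image_eq_iff[of "(*) a" "generated_frac_ideal D A" "{0}"]
      by (simp add: inj_on_def)
    ultimately have "a * x \<in> t_closure D \<pp>"
      using v_closure_subset_t_closure[of "(*) a ` A" \<pp>] A(1) gen by auto
    moreover have "t_closure D \<pp> \<subseteq> \<pp>"
      using \<pp> by (simp add: t_maximal_def proper_t_ideal_iff)
    moreover have "x \<in> D"
      using v_closure_subset_domain A(3,5) by (auto simp: I_def subset_iff)
    ultimately show "x \<in> I" by (auto simp: I_def)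
  qed
  then have "I = \<pp>" using \<pp> sub unfolding t_maximal_def by blast
  then show ?thesis using b by (auto simp: I_def)
qed

end

section \<open>Residue fields of \<open>t\<close>-maximal ideals\<close>

lemma (in domain) finite_domain_is_field:
  assumes "finite (carrier R)"
  shows "field R"
proof (rule cring_fieldI)
  have "x \<in> Units R" if x: "x \<in> carrier R" "x \<noteq> \<zero>" for x
  proof -
    have "inj_on (\<lambda>y. x \<otimes> y) (carrier R)"
      by (intro inj_onI) (use x m_lcancel in simp)
    moreover have "(\<lambda>y. x \<otimes> y) ` carrier R \<subseteq> carrier R"
      using x m_closed by blast
    ultimately have "\<one> \<in> (\<lambda>y. x \<otimes> y) ` carrier R"
      using endo_inj_surj[OF assms] one_closed by metis
    then obtain y where y: "y \<in> carrier R" "x \<otimes> y = \<one>" by force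
    then have "y \<otimes> x = \<one>" using m_comm x(1) by metis
    with x y show ?thesis unfolding Units_def by blast
  qed
  moreover have "x \<noteq> \<zero>" if "x \<in> Units R" for x
    using Units_l_inv[OF that] Units_inv_closed[OF that] zero_not_one by force
  ultimately show "Units R = carrier R - {\<zero>}"
    using Units_closed by blast
qed

text \<open>Lagrange's theorem in the multiplicative group of the field, with zero treated
  separately.\<close>

lemma (in domain) finite_domain_pow_card:
  assumes fin: "finite (carrier R)" and x: "x \<in> carrier R"
  shows "x [^] card (carrier R) = x"
proof (cases "x = \<zero>")
  case True
  then show ?thesis using assms using nat_pow_zero[of "card (carrier R)"] by auto
next
  case False
  interpret field R by (rule finite_domain_is_field[OF fin])
  interpret M: group "Multiplicative_Group.mult_of R" by (rule field_mult_group)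
  have "x [^]\<^bsub>Multiplicative_Group.mult_of R\<^esub> Coset.order (Multiplicative_Group.mult_of R) = \<one>\<^bsub>Multiplicative_Group.mult_of R\<^esub>"
    by (rule M.pow_order_eq_1) (use x False in simp)
  then have "x [^] (card (carrier R) - 1) = \<one>"
    by (simp add: Multiplicative_Group.nat_pow_mult_of Coset.order_def card_Diff_singleton fin)
  moreover have "Suc (card (carrier R) - 1) = card (carrier R)"
    using fin by (metis Suc_diff_1 card_gt_0_iff carrier_not_empty)
  ultimately show ?thesis using x by (metis l_one nat_pow_Suc)
qed

text \<open>For each prime \<open>r\<close> dividing the order, Sylow's theorem for the additive
  group gives a nonzero \<open>x\<close> annihilated by \<open>r\<close>; without zero divisors,
  \<open>r\<close> then annihilates \<open>\<one>\<close>. Two different such primes would give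
  \<open>\<one> = \<zero>\<close> by Bezout.\<close>

lemma (in domain) finite_domain_card_primepow:
  assumes fin: "finite (carrier R)"
  shows "primepow (card (carrier R))"
proof -
  let ?q = "card (carrier R)" and ?c = "\<lambda>n::nat. [n] \<cdot> \<one>"
  have c_mult: "?c (m * n) = ?c m \<otimes> ?c n" for m n
  proof -
    have "?c m \<otimes> ?c n = ([m] \<cdot> (\<one> \<otimes> ?c n))" by (rule add_pow_ldistr) auto
    also have "\<dots> = ?c (n * m)" using add.nat_pow_pow[of \<one> m n] by (simp add: mult.commute)
    finally show ?thesis by (simp add: mult.commute)
  qed
  have c_pow: "?c (m ^ n) = \<zero> \<Longrightarrow> ?c m = \<zero>" for m n
  proof (induction n)
    case (Suc n)
    have "?c m \<otimes> ?c (m ^ n) = \<zero>"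
      using Suc.prems c_mult[of m "m ^ n"] by simp
    then have "?c m = \<zero> \<or> ?c (m ^ n) = \<zero>" by (rule integral) simp_all
    then show ?case using Suc.IH by blast
  qed simp
  have "card {\<zero>, \<one>} \<le> ?q" using fin by (intro card_mono) auto
  then have "?q \<ge> 2" by (simp add: card_insert_if)
  have prime_zero: "?c r = \<zero>" if r: "prime r" "r dvd ?q" for r
  proof -
    obtain m where m: "?q = r ^ 1 * m" using r(2) unfolding dvd_def power_one_right by blast
    obtain H where H: "subgroup H (add_monoid R)" "card H = r ^ 1"
      using sylow_thm[OF r(1) a_group, of 1 m] m fin by (auto simp: Coset.order_def)
    have "\<zero> \<in> H" using subgroup.one_closed[OF H(1)] by simp
    have "H \<noteq> {\<zero>}"
    proof
      assume "H = {\<zero>}"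
      then have "r = 1" using H(2) by simp
      then show False using r(1) by simp
    qed
    with \<open>\<zero> \<in> H\<close> obtain x where x: "x \<in> H" "x \<noteq> \<zero>" by blast
    then have xc: "x \<in> carrier R" using subgroup.mem_carrier[OF H(1)] by auto
    interpret H: group "(add_monoid R)\<lparr>carrier := H\<rparr>"
      by (rule subgroup.subgroup_is_group[OF H(1) a_group])
    have "x [^]\<^bsub>(add_monoid R)\<lparr>carrier := H\<rparr>\<^esub> Coset.order ((add_monoid R)\<lparr>carrier := H\<rparr>) =
        \<one>\<^bsub>(add_monoid R)\<lparr>carrier := H\<rparr>\<^esub>"
      by (rule H.pow_order_eq_1) (use x in simp)
    then have "x [^]\<^bsub>add_monoid R\<^esub> r = \<zero>"
      using H(2) monoid.nat_pow_consistent[OF a_monoid, of x r H]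
      by (simp add: Coset.order_def del: add.nat_pow_consistent)
    then have "[r] \<cdot> x = \<zero>" by (simp add: add_pow_def)
    then have "?c r \<otimes> x = \<zero>" using xc add_pow_ldistr[of \<one> x r] by simp
    then show ?thesis using integral[of "?c r" x] x xc by simp
  qed
  obtain l where l: "prime l" "l dvd ?q" using prime_factor_nat[of ?q] \<open>?q \<ge> 2\<close> by auto
  have unique: "r = l" if r: "prime r" "r dvd ?q" for r
  proof (rule ccontr)
    assume "r \<noteq> l"
    then have "coprime r l" using r(1) l(1) by (simp add: primes_coprime)
    moreover have "l \<noteq> 1" using l(1) by auto
    ultimately obtain a b where ab: "r * a = l * b + 1"
      using coprime_bezout_strong[of r l] by blast
    have "?c (r * a) = \<zero>" unfolding c_mult prime_zero[OF r] by simp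
    moreover have "?c (l * b) = \<zero>" unfolding c_mult prime_zero[OF l] by simp
    then have "?c (l * b + 1) = \<one>" by simp
    ultimately show False unfolding ab by simp
  qed
  have "?q > 0" using \<open>?q \<ge> 2\<close> by linarith
  from prime_power_canonical[OF l(1) this]
  obtain k m where km: "?q = m * l ^ k" "\<not> l dvd m" by blast
  have "m = 1"
  proof (rule ccontr)
    assume "m \<noteq> 1"
    then obtain r where "prime r" "r dvd m" using prime_factor_nat by blast
    moreover from this have "r dvd ?q" unfolding km(1) by simp
    ultimately show False using unique[of r] km(2) by blast
  qed
  moreover have "k \<noteq> 0"
  proof
    assume "k = 0"
    with km(1) \<open>m = 1\<close> \<open>?q \<ge> 2\<close> show False by simp
  qed
  ultimately show ?thesis using km(1) l(1) by simp
qed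

context quotient_field_domain
begin

lemma coset_eq_iff:
  assumes "ideal I (ring_on D)" "x \<in> D" "y \<in> D"
  shows "I +>\<^bsub>ring_on D\<^esub> x = I +>\<^bsub>ring_on D\<^esub> y \<longleftrightarrow> x - y \<in> I"
proof -
  note I = assms(1)[unfolded ideal_iff]
  have coset: "I +>\<^bsub>ring_on D\<^esub> z = {h + z | h. h \<in> I}" for z
    by (auto simp: a_r_coset_def r_coset_def ring_on_def ring_of_type_algebra_def)
  have neg: "- z \<in> I" if "z \<in> I" for z
  proof -
    have "- 1 * z \<in> I" using I that uminus_closed[OF one_closed] by blast
    then show ?thesis by simp
  qed
  show ?thesis unfolding coset
  proof
    assume "{h + x |h. h \<in> I} = {h + y |h. h \<in> I}"
    moreover have "0 + x \<in> {h + x |h. h \<in> I}" using I by blast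
    ultimately obtain h where "0 + x = h + y" "h \<in> I" by auto
    then show "x - y \<in> I" by (simp add: algebra_simps)
  next
    assume xy: "x - y \<in> I"
    have sub: "{h + z |h. h \<in> I} \<subseteq> {h + w |h. h \<in> I}" if "z - w \<in> I" for z w
    proof
      fix v assume "v \<in> {h + z |h. h \<in> I}"
      then obtain h where "h \<in> I" "v = h + z" by blast
      then have "h + (z - w) \<in> I" "v = h + (z - w) + w" using I that by auto
      then show "v \<in> {h + w |h. h \<in> I}" by blast
    qed
    have "y - x \<in> I" using neg[OF xy] by simp
    then show "{h + x |h. h \<in> I} = {h + y |h. h \<in> I}" using sub xy by (intro equalityI)
  qed
qed

lemma carrier_Quot:
  "carrier (ring_on D Quot I) = (\<lambda>x. I +>\<^bsub>ring_on D\<^esub> x) ` D"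
  unfolding FactRing_def A_RCOSETS_def' by auto

lemma t_maximal_primeideal:
  assumes "t_maximal D \<pp>"
  shows "primeideal \<pp> (ring_on D)"
proof (rule primeidealI)
  show "ideal \<pp> (ring_on D)" by (rule t_maximal_ideal[OF assms])
  show "cring (ring_on D)" by (rule cring_ring_on)
  show "carrier (ring_on D) \<noteq> \<pp>"
    using t_maximal_one[OF assms] one_closed unfolding ring_on_simps by metis
  fix a b assume "a \<in> carrier (ring_on D)" "b \<in> carrier (ring_on D)" "a \<otimes>\<^bsub>ring_on D\<^esub> b \<in> \<pp>"
  then show "a \<in> \<pp> \<or> b \<in> \<pp>"
    using t_maximal_prime[OF assms, of a b] unfolding ring_on_simps by blast
qed

text \<open>The residue ring is a finite domain with \<open>q\<close> elements, so the facts on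
  finite domains above transfer along the quotient map.\<close>

lemma t_maximal_finite_norm:
  assumes \<pp>: "t_maximal D \<pp>" and norm: "ideal_norm D \<pp> = enat q"
  shows "primepow q" and "x \<in> D \<Longrightarrow> x ^ q - x \<in> \<pp>"
proof -
  let ?Q = "ring_on D Quot \<pp>"
  interpret P: primeideal \<pp> "ring_on D" by (rule t_maximal_primeideal[OF \<pp>])
  interpret Q: domain ?Q by (rule P.quotient_is_domain)
  have fin: "finite (carrier ?Q)" and card: "card (carrier ?Q) = q"
    using norm by (auto simp: ideal_norm_def split: if_splits)
  show "primepow q" using Q.finite_domain_card_primepow[OF fin] card by simp
  assume x: "x \<in> D"
  have "(\<pp> +>\<^bsub>ring_on D\<^esub> x) [^]\<^bsub>?Q\<^esub> n = \<pp> +>\<^bsub>ring_on D\<^esub> (x ^ n)" for n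
  proof (induction n)
    case (Suc n)
    then show ?case
      using ring_hom_mult[OF P.rcos_ring_hom, of "x ^ n" x] x
      by (simp add: power_closed mult.commute)
  qed (simp add: FactRing_def)
  then have "\<pp> +>\<^bsub>ring_on D\<^esub> (x ^ q) = \<pp> +>\<^bsub>ring_on D\<^esub> x"
    using Q.finite_domain_pow_card[OF fin, of "\<pp> +>\<^bsub>ring_on D\<^esub> x"] x unfolding card
    by (simp add: carrier_Quot)
  then show "x ^ q - x \<in> \<pp>"
    using coset_eq_iff[OF t_maximal_ideal[OF \<pp>]] x by (simp add: power_closed)
qed

lemma distinct_residues:
  assumes \<pp>: "t_maximal D \<pp>" and norm: "enat n \<le> ideal_norm D \<pp>"
  shows "\<exists>u. \<forall>i<n. u i \<in> D \<and> (\<forall>j<n. i \<noteq> j \<longrightarrow> u i - u j \<notin> \<pp>)"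
proof -
  let ?Q = "carrier (ring_on D Quot \<pp>)"
  have "\<exists>f. f ` {..<n} \<subseteq> ?Q \<and> inj_on f {..<n}"
  proof (cases "finite ?Q")
    case True
    then have "card {..<n} \<le> card ?Q" using norm by (simp add: ideal_norm_def)
    then show ?thesis using card_le_inj[OF finite_lessThan True] by blast
  next
    case False
    then obtain f :: "nat \<Rightarrow> 'k set" where "inj f" "range f \<subseteq> ?Q"
      using infinite_countable_subset by blast
    then show ?thesis by (intro exI[of _ f]) (auto intro: inj_on_subset)
  qed
  then obtain f where f: "f ` {..<n} \<subseteq> ?Q" "inj_on f {..<n}" by blast
  then have "\<forall>i<n. \<exists>x\<in>D. f i = \<pp> +>\<^bsub>ring_on D\<^esub> x" by (auto simp: carrier_Quot)
  then obtain u where u: "\<And>i. i < n \<Longrightarrow> u i \<in> D \<and> f i = \<pp> +>\<^bsub>ring_on D\<^esub> u i" by metis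
  have "u i - u j \<notin> \<pp>" if "i < n" "j < n" "i \<noteq> j" for i j
    using coset_eq_iff[OF t_maximal_ideal[OF \<pp>], of "u i" "u j"] u that f(2)
    by (auto simp: inj_on_def)
  with u show ?thesis by blast
qed

end

section \<open>Divided differences\<close>

text \<open>\<open>f\<close> equals its Lagrange interpolation polynomial \<open>g\<close>, since
  both have degree at most \<open>n\<close> and agree at \<open>n + 1\<close> points. Each basis
  polynomial \<open>l i\<close> is monic of degree \<open>n\<close>, so the coefficient can be read
  off.\<close>

lemma coeff_lagrange:
  fixes f :: "'k::field poly"
  assumes deg: "Polynomial.degree f \<le> n" and inj: "inj_on x {..n}"
  shows "Polynomial.coeff f n = (\<Sum>i\<le>n. poly f (x i) / (\<Prod>j\<in>{..n}-{i}. x i - x j))"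
proof -
  define l where "l i = (\<Prod>j\<in>{..n}-{i}. [:- x j, 1:])" for i
  define g where "g = (\<Sum>i\<le>n. Polynomial.smult (poly f (x i) / (\<Prod>j\<in>{..n}-{i}. x i - x j)) (l i))"
  have deg_l: "Polynomial.degree (l i) = n" if "i \<le> n" for i
  proof -
    have "Polynomial.degree (l i) = (\<Sum>j\<in>{..n}-{i}. Polynomial.degree [:- x j, 1:])"
      unfolding l_def by (rule degree_prod_eq_sum_degree) auto
    also have "\<dots> = n" using that by simp
    finally show ?thesis .
  qed
  have lead: "Polynomial.coeff (l i) n = 1" if "i \<le> n" for i
  proof -
    have "lead_coeff (l i) = 1" unfolding l_def by (simp add: lead_coeff_prod)
    then show ?thesis using deg_l[OF that] by simp
  qed
  have eval: "poly (l i) (x k) = (if k = i then \<Prod>j\<in>{..n}-{i}. x i - x j else 0)"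
    if "i \<le> n" "k \<le> n" for i k
    using that by (auto simp: l_def poly_prod intro!: prod_zero)
  have nz: "(\<Prod>j\<in>{..n}-{i}. x i - x j) \<noteq> 0" if "i \<le> n" for i
    using that inj by (auto simp: inj_on_def)
  have "f = g"
  proof (rule poly_eqI_degree)
    show "poly f y = poly g y" if "y \<in> x ` {..n}" for y
    proof -
      from that obtain k where k: "k \<le> n" "y = x k" by blast
      have "poly g y = (\<Sum>i\<le>n. if i = k then poly f (x i) else 0)"
        unfolding g_def k(2) poly_sum poly_smult
        by (rule sum.cong) (use nz k(1) in \<open>auto simp: eval\<close>)
      then show ?thesis using k by simp
    qed
    have card: "card (x ` {..n}) = Suc n" using card_image[OF inj] by simp
    then show "Polynomial.degree f < card (x ` {..n})" using deg by simp
    have "Polynomial.degree g \<le> n"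
      unfolding g_def by (rule degree_sum_le) (use deg_l degree_smult_le le_trans in auto)
    then show "Polynomial.degree g < card (x ` {..n})" using card by simp
  qed
  then have "Polynomial.coeff f n = Polynomial.coeff g n" by simp
  also have "\<dots> = (\<Sum>i\<le>n. poly f (x i) / (\<Prod>j\<in>{..n}-{i}. x i - x j))"
    unfolding g_def coeff_sum by (rule sum.cong) (auto simp: lead)
  finally show ?thesis .
qed

section \<open>Base \<open>q\<close> digits: the exponent and the interpolation points\<close>

text \<open>For prime \<open>q\<close> this is Legendre's formula for the exponent of \<open>q\<close> in \<open>n!\<close>.\<close>

function legendre_exp :: "nat \<Rightarrow> nat \<Rightarrow> nat" where
  "legendre_exp q n = (if q \<le> 1 \<or> n = 0 then 0 else n div q + legendre_exp q (n div q))"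
  by auto
termination by (relation "Wellfounded.measure snd") auto

declare legendre_exp.simps [simp del]

lemma legendre_exp_0 [simp]: "legendre_exp q 0 = 0"
  by (simp add: legendre_exp.simps[of q 0])

lemma legendre_exp_rec: "q > 1 \<Longrightarrow> legendre_exp q n = n div q + legendre_exp q (n div q)"
  using legendre_exp.simps[of q n] by (cases "n = 0") auto

lemma legendre_exp_less: "n < q \<Longrightarrow> legendre_exp q n = 0"
  using legendre_exp.simps[of q n] by (cases "n = 0") auto

lemma legendre_exp_mono: "m \<le> n \<Longrightarrow> legendre_exp q m \<le> legendre_exp q n"
proof (induction n arbitrary: m rule: less_induct)
  case (less n)
  show ?case
  proof (cases "q > 1 \<and> n > 0")
    case True
    then have "n div q < n" by simp
    moreover have "m div q \<le> n div q" using less.prems by (rule div_le_mono)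
    ultimately show ?thesis
      using less.IH[of "n div q" "m div q"] True by (simp add: legendre_exp_rec[of q n] legendre_exp_rec[of q m])
  next
    case False
    then have "legendre_exp q m = 0"
      using less.prems legendre_exp.simps[of q m] by auto
    then show ?thesis by simp
  qed
qed

text \<open>If \<open>n\<close> has base \<open>q\<close> digits \<open>n_0, n_1, ...\<close>, this
  is the sum of the terms \<open>u n_j * \<pi> ^ j\<close>. The value at \<open>n = 0\<close> fits
  the recursion exactly when \<open>u 0 = 0\<close>, which is why the representatives are normalized
  that way later.\<close>

function digit_point :: "(nat \<Rightarrow> 'k::field) \<Rightarrow> 'k \<Rightarrow> nat \<Rightarrow> nat \<Rightarrow> 'k" where
  "digit_point u \<pi> q n =
     (if q \<le> 1 \<or> n = 0 then 0 else u (n mod q) + \<pi> * digit_point u \<pi> q (n div q))"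
  by auto
termination by (relation "Wellfounded.measure (\<lambda>(_, _, _, n). n)") auto

declare digit_point.simps [simp del]

lemma digit_point_rec:
  "q > 1 \<Longrightarrow> u 0 = 0 \<Longrightarrow>
    digit_point u \<pi> q n = u (n mod q) + \<pi> * digit_point u \<pi> q (n div q)"
  using digit_point.simps[of u \<pi> q n] digit_point.simps[of u \<pi> q 0] by (cases "n = 0") simp_all

context quotient_field_domain
begin

lemma t_maximal_subset: "t_maximal D \<pp> \<Longrightarrow> x \<in> \<pp> \<Longrightarrow> x \<in> D"
  and t_maximal_zero: "t_maximal D \<pp> \<Longrightarrow> 0 \<in> \<pp>"
  and t_maximal_add: "t_maximal D \<pp> \<Longrightarrow> x \<in> \<pp> \<Longrightarrow> y \<in> \<pp> \<Longrightarrow> x + y \<in> \<pp>"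
  and t_maximal_mult: "t_maximal D \<pp> \<Longrightarrow> x \<in> D \<Longrightarrow> y \<in> \<pp> \<Longrightarrow> x * y \<in> \<pp>"
  using t_maximal_ideal[of \<pp>] unfolding ideal_iff by blast+

lemma prod_notin_t_maximal:
  assumes "t_maximal D \<pp>" "\<And>a. a \<in> A \<Longrightarrow> f a \<in> D - \<pp>"
  shows "prod f A \<in> D - \<pp>"
  using assms(2)
proof (induction A rule: infinite_finite_induct)
  case (insert a A)
  then show ?case using t_maximal_prime[OF assms(1), of "f a" "prod f A"] mult_closed by auto
qed (use t_maximal_one[OF assms(1)] one_closed in auto)

lemma digit_point_closed:
  assumes "\<And>i. i < q \<Longrightarrow> u i \<in> D" "\<pi> \<in> D"
  shows "digit_point u \<pi> q n \<in> D"
proof (induction n rule: less_induct)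
  case (less n)
  show ?case
  proof (cases "q \<le> 1 \<or> n = 0")
    case True
    then show ?thesis using digit_point.simps[of u \<pi> q n] zero_closed by auto
  next
    case False
    then have "digit_point u \<pi> q n = u (n mod q) + \<pi> * digit_point u \<pi> q (n div q)"
      using digit_point.simps[of u \<pi> q n] by simp
    then show ?thesis
      using less[of "n div q"] assms False add_closed mult_closed by auto
  qed
qed

text \<open>
  The factors with \<open>j \<equiv> i\<close> modulo \<open>q\<close> contribute one factor \<open>\<pi>\<close> each and otherwise the same product
  for the quotients by \<open>q\<close>; the remaining factors lie outside \<open>\<pp>\<close>.
\<close>

lemma prod_digit_point_diff:
  assumes \<pp>: "t_maximal D \<pp>" and q: "q > 1" and \<pi>: "\<pi> \<in> \<pp>" and u0: "u 0 = 0"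
    and u: "\<And>i. i < q \<Longrightarrow> u i \<in> D" "\<And>i j. i < q \<Longrightarrow> j < q \<Longrightarrow> i \<noteq> j \<Longrightarrow> u i - u j \<notin> \<pp>"
    and i: "i \<le> n"
  defines "x \<equiv> digit_point u \<pi> q"
  shows "\<exists>s\<in>D - \<pp>. \<exists>e\<le>legendre_exp q n. (\<Prod>j\<in>{..n}-{i}. x i - x j) = s * \<pi> ^ e"
  using i
proof (induction n arbitrary: i rule: less_induct)
  case (less n)
  have \<pi>D: "\<pi> \<in> D" by (rule t_maximal_subset[OF \<pp> \<pi>])
  have xD: "x k \<in> D" for k unfolding x_def by (rule digit_point_closed[OF u(1) \<pi>D])
  have rec: "x k = u (k mod q) + \<pi> * x (k div q)" for k
    unfolding x_def by (rule digit_point_rec) (use q u0 in auto)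
  show ?case
  proof (cases "n = 0")
    case True
    then have "{..n} - {i} = {}" using less.prems by auto
    then have "(\<Prod>j\<in>{..n}-{i}. x i - x j) = 1 * \<pi> ^ 0" by (simp only: prod.empty power_0 mult_1)
    moreover have "1 \<in> D - \<pp>" using one_closed t_maximal_one[OF \<pp>] by simp
    ultimately show ?thesis by blast
  next
    case False
    define r where "r = i mod q"
    \<comment> \<open>The indices up to \<open>n\<close> in the residue class of \<open>i\<close>
      are the \<open>r + q * k\<close> with \<open>k \<le> m\<close>. Depending on \<open>r\<close>,
      \<open>m\<close> may be smaller than \<open>n div q\<close>, so the exponent is only bounded
      from above.\<close>
    define m where "m = (n - r) div q"
    have "m \<le> n div q" unfolding m_def by (intro div_le_mono) simp
    then have "m < n" using False q by (meson div_less_dividend le_less_trans not_gr_zero)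
    have im: "i = r + q * (i div q)" unfolding r_def by simp
    have le_m: "r + q * k \<le> n \<longleftrightarrow> k \<le> m" for k
    proof -
      have "r \<le> n" using less.prems mod_less_eq_dividend[of i q] unfolding r_def by linarith
      then have "r + q * k \<le> n \<longleftrightarrow> k * q \<le> n - r" by (auto simp: mult.commute)
      also have "\<dots> \<longleftrightarrow> k \<le> m" unfolding m_def using q by (simp add: less_eq_div_iff_mult_less_eq)
      finally show ?thesis .
    qed
    have "i div q \<le> m" using le_m[of "i div q"] im less.prems by simp
    from less.IH[OF \<open>m < n\<close> this] obtain s e where s: "s \<in> D - \<pp>" "e \<le> legendre_exp q m"
      "(\<Prod>j\<in>{..m}-{i div q}. x (i div q) - x j) = s * \<pi> ^ e" by blast
    let ?A = "{j\<in>{..n}. j mod q \<noteq> r}" and ?B = "(\<lambda>k. r + q * k) ` ({..m} - {i div q})"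
    have "r < q" unfolding r_def using q by simp
    have split: "{..n} - {i} = ?A \<union> ?B"
    proof (intro equalityI subsetI)
      fix j assume j: "j \<in> {..n} - {i}"
      show "j \<in> ?A \<union> ?B"
      proof (cases "j mod q = r")
        case True
        then have jd: "j = r + q * (j div q)" by (metis mod_mult_div_eq)
        then have "j div q \<le> m" using le_m[of "j div q"] j by simp
        moreover have "j div q \<noteq> i div q" using jd im j by auto
        ultimately show ?thesis using jd by blast
      qed (use j in auto)
    next
      fix j assume "j \<in> ?A \<union> ?B"
      then consider "j \<in> ?A" | k where "j = r + q * k" "k \<le> m" "k \<noteq> i div q" by blast
      then show "j \<in> {..n} - {i}"
      proof cases
        case 1
        then show ?thesis unfolding r_def by auto
      next
        case 2
        moreover have "j \<noteq> i" using 2 im q by (metis add_left_cancel mult_cancel1 not_less_zero)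
        ultimately show ?thesis using le_m[of k] by auto
      qed
    qed
    have "?A \<inter> ?B = {}" using \<open>r < q\<close> by auto
    have A: "(\<Prod>j\<in>?A. x i - x j) \<in> D - \<pp>"
    proof (rule prod_notin_t_maximal[OF \<pp>])
      fix j assume j: "j \<in> ?A"
      have "x i - x j \<notin> \<pp>"
      proof
        assume *: "x i - x j \<in> \<pp>"
        \<comment> \<open>Adding this multiple of \<open>\<pi>\<close> leaves the difference of the
          representatives of the lowest digits, which are incongruent modulo
          \<open>\<pp>\<close>.\<close>
        have "(x (j div q) - x (i div q)) * \<pi> \<in> \<pp>"
          by (rule t_maximal_mult[OF \<pp> diff_closed[OF xD xD] \<pi>])
        with * have "(x i - x j) + (x (j div q) - x (i div q)) * \<pi> \<in> \<pp>"
          by (rule t_maximal_add[OF \<pp>])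
        moreover have "(x i - x j) + (x (j div q) - x (i div q)) * \<pi> = u (i mod q) - u (j mod q)"
          using rec[of i] rec[of j] by (simp add: algebra_simps)
        ultimately show False using u(2)[of "i mod q" "j mod q"] q j by (auto simp: r_def)
      qed
      then show "x i - x j \<in> D - \<pp>" using diff_closed[OF xD xD] by simp
    qed
    have card: "card ({..m} - {i div q}) = m" using \<open>i div q \<le> m\<close> by simp
    have "(\<Prod>j\<in>?B. x i - x j) = (\<Prod>k\<in>{..m}-{i div q}. x i - x (r + q * k))"
      by (subst prod.reindex) (use q in \<open>auto simp: inj_on_def\<close>)
    also have "\<dots> = (\<Prod>k\<in>{..m}-{i div q}. \<pi> * (x (i div q) - x k))"
    proof (rule prod.cong[OF refl])
      fix k
      have "(r + q * k) mod q = r" "(r + q * k) div q = k" using \<open>r < q\<close> q by auto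
      then show "x i - x (r + q * k) = \<pi> * (x (i div q) - x k)"
        using rec[of i] rec[of "r + q * k"] unfolding r_def[symmetric] by (simp add: algebra_simps)
    qed
    also have "\<dots> = s * \<pi> ^ (m + e)" by (simp add: prod.distrib s(3) card power_add)
    finally have B: "(\<Prod>j\<in>?B. x i - x j) = s * \<pi> ^ (m + e)" .
    have "(\<Prod>j\<in>{..n}-{i}. x i - x j) = (\<Prod>j\<in>?A. x i - x j) * (\<Prod>j\<in>?B. x i - x j)"
      unfolding split by (rule prod.union_disjoint) (use \<open>?A \<inter> ?B = {}\<close> in auto)
    then have "(\<Prod>j\<in>{..n}-{i}. x i - x j) = ((\<Prod>j\<in>?A. x i - x j) * s) * \<pi> ^ (m + e)"
      using B by (simp add: mult.assoc)
    moreover have "(\<Prod>j\<in>?A. x i - x j) * s \<in> D - \<pp>"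
      using A s(1) t_maximal_prime[OF \<pp>, of "\<Prod>j\<in>?A. x i - x j" s] mult_closed by blast
    moreover have "m + e \<le> legendre_exp q n"
      using s(2) \<open>m \<le> n div q\<close> legendre_exp_mono[OF \<open>m \<le> n div q\<close>, of q]
      by (simp add: legendre_exp_rec[OF q, of n])
    ultimately show ?thesis by blast
  qed
qed

text \<open>Clears the denominators in \<open>coeff_lagrange\<close>: the product of all
  \<open>s i\<close> stays outside the prime \<open>\<pp>\<close>, and \<open>\<pi> ^ w\<close>
  absorbs every power of \<open>\<pi>\<close> that occurs.\<close>

lemma locally_mem_coeff:
  assumes \<pp>: "t_maximal D \<pp>" and \<pi>: "\<pi> \<in> D" "\<pi> \<noteq> 0"
    and f: "f \<in> int_valued D" "Polynomial.degree f \<le> n"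
    and x: "\<And>i. i \<le> n \<Longrightarrow> x i \<in> D"
      "\<And>i. i \<le> n \<Longrightarrow> \<exists>s\<in>D - \<pp>. \<exists>e\<le>w. (\<Prod>j\<in>{..n}-{i}. x i - x j) = s * \<pi> ^ e"
  shows "\<exists>s\<in>D - \<pp>. s * (\<pi> ^ w * Polynomial.coeff f n) \<in> D"
proof -
  have "0 \<in> \<pp>" by (rule t_maximal_zero[OF \<pp>])
  obtain s e where s: "\<And>i. i \<le> n \<Longrightarrow> s i \<in> D - \<pp>" "\<And>i. i \<le> n \<Longrightarrow> e i \<le> w"
    "\<And>i. i \<le> n \<Longrightarrow> (\<Prod>j\<in>{..n}-{i}. x i - x j) = s i * \<pi> ^ e i" using x(2) by metis
  have s0: "s i \<noteq> 0" if "i \<le> n" for i using s(1)[OF that] \<open>0 \<in> \<pp>\<close> by auto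
  have nz: "(\<Prod>j\<in>{..n}-{i}. x i - x j) \<noteq> 0" if "i \<le> n" for i
    using s(3)[OF that] s0[OF that] \<pi>(2) by simp
  \<comment> \<open>\<open>coeff_lagrange\<close> requires distinct points; a coincidence would make
    one of the products of differences vanish.\<close>
  have inj: "inj_on x {..n}"
  proof (rule inj_onI)
    fix i j assume "i \<in> {..n}" "j \<in> {..n}" "x i = x j"
    then show "i = j" using nz[of i] by (auto simp: prod_zero_iff)
  qed
  define S where "S = (\<Prod>i\<le>n. s i)"
  have "S \<in> D - \<pp>" unfolding S_def by (rule prod_notin_t_maximal[OF \<pp>]) (use s(1) in auto)
  moreover have "S * (\<pi> ^ w * Polynomial.coeff f n) =
      (\<Sum>i\<le>n. (\<Prod>j\<in>{..n}-{i}. s j) * \<pi> ^ (w - e i) * poly f (x i))"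
    unfolding coeff_lagrange[OF f(2) inj] sum_distrib_left
  proof (rule sum.cong[OF refl])
    fix i assume "i \<in> {..n}"
    then have i: "i \<le> n" by simp
    have "S = s i * (\<Prod>j\<in>{..n}-{i}. s j)" unfolding S_def using i by (subst prod.remove[of _ i]) auto
    moreover have "\<pi> ^ w = \<pi> ^ (w - e i) * \<pi> ^ e i" using s(2)[OF i] by (simp flip: power_add)
    ultimately show "S * (\<pi> ^ w * (poly f (x i) / (\<Prod>j\<in>{..n} - {i}. x i - x j))) =
        (\<Prod>j\<in>{..n}-{i}. s j) * \<pi> ^ (w - e i) * poly f (x i)"
      using s0[OF i] \<pi>(2) by (simp add: s(3)[OF i] field_simps)
  qed
  moreover have "\<dots> \<in> D"
    using s(1) \<pi>(1) x(1) f(1)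
    by (intro sum_closed mult_closed prod_closed power_closed) (auto simp: int_valued_def)
  ultimately show ?thesis by (intro bexI[of _ S]) simp_all
qed

end

section \<open>Comaximality and the leading coefficients of \<open>Int(D)\<close>\<close>

locale class_C_domain =
  fixes D :: "'k::field set" and \<pi> :: "nat \<Rightarrow> 'k"
  assumes class_C: "class_C D"
    and generator: "\<And>q. primepow q \<Longrightarrow> \<pi> q \<in> D \<and> Pi_ideal D q = Idl\<^bsub>ring_on D\<^esub> {\<pi> q}"
begin

sublocale quotient_field_domain D
  using class_C unfolding class_C_def by unfold_locales blast

abbreviation t_maximals :: "nat \<Rightarrow> 'k set set" where
  "t_maximals q \<equiv> {\<pp>. t_maximal D \<pp> \<and> ideal_norm D \<pp> = enat q}"

lemma finite_t_maximals: "finite (t_maximals q)"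
proof (rule finite_subset)
  show "t_maximals q \<subseteq> {\<pp>. t_maximal D \<pp> \<and> ideal_norm D \<pp> \<le> enat q}" by auto
  show "finite {\<pp>. t_maximal D \<pp> \<and> ideal_norm D \<pp> \<le> enat q}"
    using class_C unfolding class_C_def by blast
qed

lemma Pi_ideal_iff: "x \<in> Pi_ideal D q \<longleftrightarrow> x \<in> D \<and> (\<forall>\<pp>\<in>t_maximals q. x \<in> \<pp>)"
  by (auto simp: Pi_ideal_def)

lemma generator_closed: "primepow q \<Longrightarrow> \<pi> q \<in> D"
  using generator by blast

lemma Pi_ideal_eq:
  assumes "primepow q"
  shows "Pi_ideal D q = (\<lambda>d. d * \<pi> q) ` D"
proof -
  interpret R: cring "ring_on D" by (rule cring_ring_on)
  have "Pi_ideal D q = PIdl\<^bsub>ring_on D\<^esub> (\<pi> q)"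
    using generator[OF assms] R.cgenideal_eq_genideal[of "\<pi> q"] by simp
  also have "\<dots> = (\<lambda>d. d * \<pi> q) ` D" by (auto simp: cgenideal_def)
  finally show ?thesis .
qed

lemma generator_mem:
  assumes "\<pp> \<in> t_maximals q" "primepow q"
  shows "\<pi> q \<in> \<pp>"
proof -
  have "1 * \<pi> q \<in> Pi_ideal D q" unfolding Pi_ideal_eq[OF assms(2)] using one_closed by blast
  then show ?thesis using assms(1) Pi_ideal_iff[of "\<pi> q" q] by simp
qed

text \<open>As there are only finitely many \<open>t\<close>-maximal ideals of norm
  \<open>q\<close>, a product of nonzero elements, one from each, is a nonzero element of
  \<open>Pi_ideal D q\<close>.\<close>

lemma generator_nonzero:
  assumes "primepow q"
  shows "\<pi> q \<noteq> 0"
proof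
  assume "\<pi> q = 0"
  have "\<forall>\<pp>\<in>t_maximals q. \<exists>x\<in>\<pp>. x \<noteq> 0" using t_maximal_nonzero by blast
  then obtain x where x: "\<And>\<pp>. \<pp> \<in> t_maximals q \<Longrightarrow> x \<pp> \<in> \<pp> \<and> x \<pp> \<noteq> 0" by metis
  have xD: "x \<pp> \<in> D" if "\<pp> \<in> t_maximals q" for \<pp>
    using x[OF that] t_maximal_subset[of \<pp>] that by simp
  define z where "z = prod x (t_maximals q)"
  have "z \<in> \<pp>" if \<pp>: "\<pp> \<in> t_maximals q" for \<pp>
  proof -
    have "z = prod x (t_maximals q - {\<pp>}) * x \<pp>"
      unfolding z_def using prod.remove[OF finite_t_maximals \<pp>, of x] by (simp add: mult.commute)
    moreover have "prod x (t_maximals q - {\<pp>}) \<in> D" by (rule prod_closed) (use xD in blast)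
    ultimately show ?thesis using t_maximal_mult x[OF \<pp>] \<pp> by simp
  qed
  moreover have "z \<in> D" unfolding z_def by (rule prod_closed) (rule xD)
  ultimately have "z \<in> Pi_ideal D q" unfolding Pi_ideal_iff by blast
  then have "z = 0" unfolding Pi_ideal_eq[OF assms] \<open>\<pi> q = 0\<close> by auto
  moreover have "z \<noteq> 0" unfolding z_def using finite_t_maximals x by auto
  ultimately show False by blast
qed

lemma F_poly_int_valued:
  assumes "primepow q"
  shows "F_poly \<pi> q \<in> int_valued D"
  unfolding int_valued_def
proof (intro CollectI ballI)
  fix x assume x: "x \<in> D"
  have "x ^ q - x \<in> Pi_ideal D q"
    unfolding Pi_ideal_iff using t_maximal_finite_norm(2) x diff_closed power_closed by auto
  then obtain d where "d \<in> D" "x ^ q - x = d * \<pi> q" unfolding Pi_ideal_eq[OF assms] by blast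
  then show "poly (F_poly \<pi> q) x \<in> D"
    using generator_nonzero[OF assms] by (simp add: F_poly_def)
qed

lemma one_minus_prod_mem:
  assumes \<pp>: "t_maximal D \<pp>"
    and f: "\<And>t. t \<in> T \<Longrightarrow> f t \<in> D" "\<And>t. t \<in> T \<Longrightarrow> 1 - f t \<in> \<pp>"
  shows "1 - prod f T \<in> \<pp>"
  using f
proof (induction T rule: infinite_finite_induct)
  case (insert t T)
  have "f t * (1 - prod f T) \<in> \<pp>" using insert t_maximal_mult[OF \<pp>] by simp
  moreover have "1 - f t \<in> \<pp>" using insert by simp
  ultimately have "(1 - f t) + f t * (1 - prod f T) \<in> \<pp>" by (intro t_maximal_add[OF \<pp>])
  then show ?case using insert by (simp add: algebra_simps)
qed (use t_maximal_zero[OF \<pp>] in simp_all)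

lemma prod_mem_t_maximal:
  assumes \<pp>: "t_maximal D \<pp>" and T: "finite T" "t \<in> T" "f t \<in> \<pp>"
    and f: "\<And>t. t \<in> T \<Longrightarrow> f t \<in> D"
  shows "prod f T \<in> \<pp>"
proof -
  have "prod f T = prod f (T - {t}) * f t"
    using prod.remove[OF T(1,2), of f] by (simp add: mult.commute)
  moreover have "prod f (T - {t}) \<in> D" by (rule prod_closed) (use f in blast)
  ultimately show ?thesis using t_maximal_mult[OF \<pp> _ T(3)] by simp
qed

text \<open>Distinct \<open>t\<close>-maximal ideals need not be comaximal in general; here the
  finite residue field at \<open>Q\<close> forces it. An element \<open>x\<close> of
  \<open>P\<close> outside \<open>Q\<close> satisfies \<open>x ^ r = x\<close> modulo the prime
  \<open>Q\<close>, so \<open>y = x ^ (r - 1)\<close> is congruent to \<open>1\<close>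
  there.\<close>

lemma t_maximals_comaximal:
  assumes P: "P \<in> t_maximals q" and Q: "Q \<in> t_maximals r" and "q \<noteq> r"
  shows "\<exists>y\<in>P. 1 - y \<in> Q"
proof -
  have P': "t_maximal D P" and Q': "t_maximal D Q" using P Q by simp_all
  have "P \<noteq> Q" using P Q \<open>q \<noteq> r\<close> by auto
  then have "\<not> P \<subseteq> Q" using P' Q' unfolding t_maximal_def by blast
  then obtain x where x: "x \<in> P" "x \<notin> Q" by blast
  have xD: "x \<in> D" using t_maximal_subset[OF P' x(1)] .
  have r: "primepow r" "x ^ r - x \<in> Q"
    using t_maximal_finite_norm[OF Q', of r] Q xD by simp_all
  \<comment> \<open>Since \<open>r\<close> is at least 2, the exponent \<open>r - 1 = Suc m\<close>
    is positive, which keeps the power of \<open>x\<close> inside \<open>P\<close>.\<close>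
  then obtain m where m: "r = Suc (Suc m)"
    using primepow_gt_Suc_0[OF r(1)] less_imp_Suc_add[of "Suc 0" r] by auto
  have "x * (x ^ Suc m - 1) \<in> Q" using r(2) unfolding m by (simp add: algebra_simps)
  then have *: "x ^ Suc m - 1 \<in> Q"
    by (rule t_maximal_prime[OF Q' xD x(2) diff_closed[OF power_closed[OF xD] one_closed]])
  have "- 1 * (x ^ Suc m - 1) \<in> Q"
    by (rule t_maximal_mult[OF Q' uminus_closed[OF one_closed] *])
  moreover have "x ^ m * x \<in> P" by (rule t_maximal_mult[OF P' power_closed[OF xD] x(1)])
  ultimately show ?thesis by (intro bexI[of _ "x ^ Suc m"]) (simp_all add: mult.commute[of x])
qed

text \<open>Chinese remainder argument: \<open>e Q\<close> lies in every \<open>P\<close> of norm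
  \<open>q\<close> and is \<open>1\<close> modulo \<open>Q\<close>. Hence \<open>z\<close>, the
  product of the \<open>1 - e Q\<close>, lies in every \<open>Q\<close> of norm \<open>r\<close> and
  is \<open>1\<close> modulo every \<open>P\<close>, so that \<open>z\<close> and
  \<open>1 - z\<close> are multiples of the two generators.\<close>

lemma generators_comaximal:
  assumes "primepow q" "primepow r" "q \<noteq> r"
  shows "\<exists>u\<in>D. \<exists>v\<in>D. u * \<pi> q + v * \<pi> r = 1"
proof -
  define y where "y Q P = (SOME y. y \<in> P \<and> 1 - y \<in> Q)" for Q P :: "'k set"
  have y: "y Q P \<in> P \<and> 1 - y Q P \<in> Q" if "Q \<in> t_maximals r" "P \<in> t_maximals q" for Q P
    using t_maximals_comaximal[OF that(2,1) assms(3)] unfolding y_def Bex_def by (rule someI_ex)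
  have yD: "y Q P \<in> D" if "Q \<in> t_maximals r" "P \<in> t_maximals q" for Q P
    using y[OF that] t_maximal_subset[of P] that(2) by simp
  define e where "e Q = prod (y Q) (t_maximals q)" for Q
  have eD: "e Q \<in> D" if "Q \<in> t_maximals r" for Q
    unfolding e_def by (rule prod_closed) (rule yD[OF that])
  have e1: "1 - e Q \<in> Q" if "Q \<in> t_maximals r" for Q
    unfolding e_def by (rule one_minus_prod_mem) (use y yD that in auto)
  have e0: "e Q \<in> P" if "Q \<in> t_maximals r" "P \<in> t_maximals q" for Q P
    unfolding e_def
    by (rule prod_mem_t_maximal[OF _ finite_t_maximals that(2)]) (use y yD that in auto)
  define z where "z = (\<Prod>Q\<in>t_maximals r. 1 - e Q)"
  have zD: "z \<in> D" unfolding z_def by (rule prod_closed) (intro diff_closed one_closed eD)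
  have z0: "z \<in> Q" if "Q \<in> t_maximals r" for Q
    unfolding z_def
    by (rule prod_mem_t_maximal[OF _ finite_t_maximals that])
      (use e1 that diff_closed one_closed eD in auto)
  have z1: "1 - z \<in> P" if "P \<in> t_maximals q" for P
    unfolding z_def
    by (rule one_minus_prod_mem) (use that e0 diff_closed one_closed eD in auto)
  have "z \<in> Pi_ideal D r" "1 - z \<in> Pi_ideal D q"
    unfolding Pi_ideal_iff using zD z0 z1 diff_closed[OF one_closed zD] by simp_all
  then obtain u v where "u \<in> D" "1 - z = u * \<pi> q" "v \<in> D" "z = v * \<pi> r"
    unfolding Pi_ideal_eq[OF assms(1)] Pi_ideal_eq[OF assms(2)] by blast
  then show ?thesis by (metis diff_add_cancel)
qed

section \<open>Products of generators away from \<open>q\<close>\<close>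

text \<open>
  The products of the \<open>\<pi>\<^sub>r\<close> with \<open>r \<noteq> q\<close> play the role of the denominators that become units after
  localizing at the maximal ideals of norm \<open>q\<close>.
\<close>

inductive_set away :: "nat \<Rightarrow> 'k set" for q where
  away_one: "1 \<in> away q"
| away_step: "s \<in> away q \<Longrightarrow> primepow r \<Longrightarrow> r \<noteq> q \<Longrightarrow> \<pi> r * s \<in> away q"

lemma away_closed: "s \<in> away q \<Longrightarrow> s \<in> D"
  by (induction rule: away.induct) (auto intro: one_closed mult_closed generator_closed)

lemma away_mult: "s \<in> away q \<Longrightarrow> t \<in> away q \<Longrightarrow> s * t \<in> away q"
  by (induction rule: away.induct) (auto simp: mult.assoc intro: away.intros)

lemma away_prod: "(\<And>a. a \<in> A \<Longrightarrow> f a \<in> away q) \<Longrightarrow> prod f A \<in> away q"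
  by (induction A rule: infinite_finite_induct) (auto intro: away_one away_mult)

lemma away_power:
  assumes "primepow r" "r \<noteq> q"
  shows "\<pi> r ^ e \<in> away q"
  by (induction e) (use assms in \<open>auto intro: away.intros\<close>)

text \<open>The Bezout relation for a product is obtained by multiplying those for its
  factors.\<close>

lemma away_generator_comaximal:
  assumes "s \<in> away q" "primepow q"
  shows "\<exists>u\<in>D. \<exists>v\<in>D. u * \<pi> q + v * s = 1"
  using assms(1)
proof (induction rule: away.induct)
  case away_one
  then show ?case using zero_closed one_closed by (intro bexI[of _ 0] bexI[of _ 1]) auto
next
  case (away_step s r)
  then obtain u v where uv: "u \<in> D" "v \<in> D" "u * \<pi> q + v * s = 1" by blast
  obtain u' v' where uv': "u' \<in> D" "v' \<in> D" "u' * \<pi> q + v' * \<pi> r = 1"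
    using generators_comaximal[OF assms(2) away_step(2)] away_step(3) by metis
  have "(u * \<pi> q + v * s) * (u' * \<pi> q + v' * \<pi> r) = 1" using uv(3) uv'(3) by simp
  then have "(u * (u' * \<pi> q + v' * \<pi> r) + v * s * u') * \<pi> q + (v * v') * (\<pi> r * s) = 1"
    by (simp add: algebra_simps)
  moreover have "u * (u' * \<pi> q + v' * \<pi> r) + v * s * u' \<in> D"
    using uv uv' away_closed[OF away_step(1)] one_closed by (auto intro!: add_closed mult_closed)
  ultimately show ?case using mult_closed uv(2) uv'(2) by blast
qed

text \<open>
  An element of \<open>I\<close> that is a product of \<open>\<pi>\<close>'s loses its factors one at a time: to remove \<open>\<pi>\<^sub>q\<close>,
  combine it with the element of \<open>I\<close> that is comaximal to \<open>\<pi>\<^sub>q\<close>.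
\<close>

lemma one_mem_if_away:
  assumes add: "\<And>x y. x \<in> I \<Longrightarrow> y \<in> I \<Longrightarrow> x + y \<in> I"
    and mult: "\<And>d x. d \<in> D \<Longrightarrow> x \<in> I \<Longrightarrow> d * x \<in> I"
    and away: "\<And>q. primepow q \<Longrightarrow> \<exists>s\<in>away q. s \<in> I"
  shows "1 \<in> I"
proof -
  \<comment> \<open>The prime power 2 is an arbitrary choice; it only supplies some product of
    generators in \<open>I\<close> from which to start.\<close>
  have reduce: "s \<in> I \<Longrightarrow> 1 \<in> I" if "s \<in> away 2" for s
    using that
  proof (induction rule: away.induct)
    case (away_step s q)
    obtain t where t: "t \<in> away q" "t \<in> I" using away away_step.hyps by blast
    obtain u v where uv: "u \<in> D" "v \<in> D" "u * \<pi> q + v * t = 1"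
      using away_generator_comaximal[OF t(1)] away_step.hyps by blast
    have "u * (\<pi> q * s) + (v * s) * t \<in> I"
      by (rule add; rule mult)
        (use away_step.prems uv t away_closed[OF away_step.hyps(1)] mult_closed in simp_all)
    also have "u * (\<pi> q * s) + (v * s) * t = (u * \<pi> q + v * t) * s" by (simp add: algebra_simps)
    finally show ?case using away_step.IH uv by simp
  qed
  have "primepow (2::nat)" by simp
  with away reduce show ?thesis by blast
qed

text \<open>A generalized factorial: over the integers it is \<open>n!\<close> up to sign, as
  \<open>\<pi> q\<close> is then \<open>q\<close> up to sign for prime \<open>q\<close> and a unit
  otherwise. Prime powers above \<open>n\<close> would contribute exponent 0.\<close>

definition char_denom :: "nat \<Rightarrow> 'k" where
  "char_denom n = (\<Prod>q\<in>{q. primepow q \<and> q \<le> n}. \<pi> q ^ legendre_exp q n)"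

lemma finite_primepow_le: "finite {q::nat. primepow q \<and> q \<le> n}"
  by (rule finite_subset[of _ "{..n}"]) auto

lemma char_denom_nonzero: "char_denom n \<noteq> 0"
  unfolding char_denom_def using generator_nonzero finite_primepow_le by (auto simp: prod_zero_iff)

lemma char_denom_away:
  assumes "primepow q"
  shows "\<exists>s\<in>away q. char_denom n = \<pi> q ^ legendre_exp q n * s"
proof -
  let ?P = "{q. primepow q \<and> q \<le> n}"
  define s where "s = (\<Prod>r\<in>?P - {q}. \<pi> r ^ legendre_exp r n)"
  have "s \<in> away q"
    unfolding s_def by (rule away_prod) (auto intro: away_power)
  moreover have "char_denom n = \<pi> q ^ legendre_exp q n * s"
  proof (cases "q \<le> n")
    case True
    then show ?thesis unfolding char_denom_def s_def
      by (subst prod.remove[of _ q]) (use assms finite_primepow_le in auto)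
  next
    case False
    then have "?P - {q} = ?P" by auto
    with False show ?thesis unfolding char_denom_def s_def by (simp add: legendre_exp_less)
  qed
  ultimately show ?thesis by blast
qed

lemma char_denom_mult_coeff:
  assumes f: "f \<in> int_valued D" "Polynomial.degree f \<le> n"
  shows "char_denom n * Polynomial.coeff f n \<in> D"
proof (rule mem_if_locally_mem)
  fix \<pp> assume \<pp>: "t_maximal D \<pp>"
  have denD: "char_denom n \<in> D"
    unfolding char_denom_def by (intro prod_closed power_closed generator_closed) auto
  show "\<exists>s\<in>D - \<pp>. s * (char_denom n * Polynomial.coeff f n) \<in> D"
  proof (cases "enat (Suc n) \<le> ideal_norm D \<pp>")
    case True
    then obtain x where x: "\<And>i. i < Suc n \<Longrightarrow> x i \<in> D"
      "\<And>i j. i < Suc n \<Longrightarrow> j < Suc n \<Longrightarrow> i \<noteq> j \<Longrightarrow> x i - x j \<notin> \<pp>"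
      using distinct_residues[OF \<pp>] by metis
    \<comment> \<open>The products of differences already lie outside \<open>\<pp>\<close>, so
      \<open>locally_mem_coeff\<close> applies with \<open>1\<close> in place of
      \<open>\<pi>\<close> and with exponent bound 0.\<close>
    have "\<exists>s\<in>D - \<pp>. \<exists>e\<le>0. (\<Prod>j\<in>{..n}-{i}. x i - x j) = s * 1 ^ e" if "i \<le> n" for i
    proof -
      have "(\<Prod>j\<in>{..n}-{i}. x i - x j) \<in> D - \<pp>"
        by (rule prod_notin_t_maximal[OF \<pp>]) (use x that diff_closed in auto)
      then show ?thesis by auto
    qed
    from locally_mem_coeff[OF \<pp> one_closed _ f _ this] x(1)
    obtain s where s: "s \<in> D - \<pp>" "s * (1 ^ 0 * Polynomial.coeff f n) \<in> D" by auto
    then have "char_denom n * (s * Polynomial.coeff f n) \<in> D"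
      using denD mult_closed by simp
    with s(1) show ?thesis by (auto simp: mult.left_commute)
  next
    case False
    then obtain q where q: "ideal_norm D \<pp> = enat q" "q \<le> n" by (cases "ideal_norm D \<pp>") auto
    have pp: "primepow q" by (rule t_maximal_finite_norm[OF \<pp> q(1)])
    then have "q > 1" using primepow_gt_Suc_0 by simp
    obtain u0 where u0: "\<And>i. i < q \<Longrightarrow> u0 i \<in> D"
      "\<And>i j. i < q \<Longrightarrow> j < q \<Longrightarrow> i \<noteq> j \<Longrightarrow> u0 i - u0 j \<notin> \<pp>"
      using distinct_residues[OF \<pp>, of q] q(1) by force
    \<comment> \<open>Translation preserves the differences and achieves \<open>u 0 = 0\<close>, as
      \<open>digit_point_rec\<close> requires.\<close>
    define u where "u i = u0 i - u0 0" for i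
    have u: "u 0 = 0" "\<And>i. i < q \<Longrightarrow> u i \<in> D"
      "\<And>i j. i < q \<Longrightarrow> j < q \<Longrightarrow> i \<noteq> j \<Longrightarrow> u i - u j \<notin> \<pp>"
      using u0 \<open>q > 1\<close> diff_closed unfolding u_def by auto
    have mem: "\<pi> q \<in> \<pp>" using generator_mem[of \<pp> q] \<pp> q(1) pp by simp
    have prods: "\<exists>s\<in>D - \<pp>. \<exists>e\<le>legendre_exp q n.
        (\<Prod>j\<in>{..n}-{i}. digit_point u (\<pi> q) q i - digit_point u (\<pi> q) q j) = s * \<pi> q ^ e"
      if "i \<le> n" for i
      by (rule prod_digit_point_diff[OF \<pp> \<open>q > 1\<close> mem]) (use u that in auto)
    have "digit_point u (\<pi> q) q i \<in> D" for i
      by (rule digit_point_closed) (use u generator_closed pp in auto)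
    from locally_mem_coeff[OF \<pp> generator_closed[OF pp] generator_nonzero[OF pp] f this prods]
    obtain s where s: "s \<in> D - \<pp>" "s * (\<pi> q ^ legendre_exp q n * Polynomial.coeff f n) \<in> D"
      by blast
    \<comment> \<open>The remaining prime powers enter only through a factor \<open>t\<close> in
      \<open>D\<close>, so the bound for \<open>q\<close> alone suffices at
      \<open>\<pp>\<close>.\<close>
    obtain t where t: "t \<in> away q" "char_denom n = \<pi> q ^ legendre_exp q n * t"
      using char_denom_away[OF pp] by blast
    have "t * (s * (\<pi> q ^ legendre_exp q n * Polynomial.coeff f n)) \<in> D"
      using s(2) away_closed[OF t(1)] mult_closed by blast
    then have "s * (char_denom n * Polynomial.coeff f n) \<in> D"
      unfolding t(2) by (simp add: mult_ac)
    with s(1) show ?thesis by blast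
  qed
qed

end

section \<open>Polynomials in a set of variables\<close>

text \<open>Common form of evaluation, substitution and linear combinations of digit products:
  coefficients are carried over by \<open>h\<close>, and \<open>b\<close> gives the values on basis
  elements.\<close>

definition mlin :: "('k::zero \<Rightarrow> 'r::comm_ring_1) \<Rightarrow> ('m \<Rightarrow> 'r) \<Rightarrow> ('m \<Rightarrow>\<^sub>0 'k) \<Rightarrow> 'r" where
  "mlin h b f = (\<Sum>m\<in>Poly_Mapping.keys f. h (Poly_Mapping.lookup f m) * b m)"

lemma mlin_superset:
  assumes "h 0 = 0" "finite S" "Poly_Mapping.keys f \<subseteq> S"
  shows "mlin h b f = (\<Sum>m\<in>S. h (Poly_Mapping.lookup f m) * b m)"
  unfolding mlin_def using assms
  by (intro sum.mono_neutral_left) (auto simp: not_in_keys_iff_lookup_eq_zero)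

lemma mlin_zero [simp]: "mlin h b 0 = 0"
  by (simp add: mlin_def)

lemma mlin_single: "h 0 = 0 \<Longrightarrow> mlin h b (Poly_Mapping.single m c) = h c * b m"
  by (cases "c = 0") (simp_all add: mlin_def)

lemma mlin_add:
  assumes "h 0 = 0" "\<And>a b. h (a + b) = h a + h b"
  shows "mlin h b (f + g) = mlin h b f + mlin h b g"
proof -
  let ?S = "Poly_Mapping.keys f \<union> Poly_Mapping.keys g"
  have "finite ?S" by simp
  then have "mlin h b (f + g) = (\<Sum>m\<in>?S. h (Poly_Mapping.lookup (f + g) m) * b m)"
    by (intro mlin_superset[where h = h, OF assms(1)] keys_add)
  also have "\<dots> = (\<Sum>m\<in>?S. h (Poly_Mapping.lookup f m) * b m) + (\<Sum>m\<in>?S. h (Poly_Mapping.lookup g m) * b m)"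
    by (simp add: lookup_add assms(2) distrib_right sum.distrib)
  also have "\<dots> = mlin h b f + mlin h b g"
    using mlin_superset[where h = h and b = b and S = ?S and f = f]
      mlin_superset[where h = h and b = b and S = ?S and f = g] assms(1) \<open>finite ?S\<close> by simp
  finally show ?thesis .
qed

lemma poly_mapping_sum_single:
  fixes f :: "'a \<Rightarrow>\<^sub>0 'b::comm_monoid_add"
  shows "f = (\<Sum>m\<in>Poly_Mapping.keys f. Poly_Mapping.single m (Poly_Mapping.lookup f m))"
proof (rule poly_mapping_eqI)
  fix k
  have "(\<Sum>m\<in>Poly_Mapping.keys f. Poly_Mapping.lookup (Poly_Mapping.single m (Poly_Mapping.lookup f m)) k) =
      (\<Sum>m\<in>Poly_Mapping.keys f. if m = k then Poly_Mapping.lookup f k else 0)"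
    by (rule sum.cong) (auto simp: lookup_single when_def)
  then show "Poly_Mapping.lookup f k =
      Poly_Mapping.lookup (\<Sum>m\<in>Poly_Mapping.keys f. Poly_Mapping.single m (Poly_Mapping.lookup f m)) k"
    by (simp add: lookup_sum not_in_keys_iff_lookup_eq_zero)
qed

text \<open>The \<open>single\<close> case ranges only over terms that occur in \<open>f\<close>, so
  information about the coefficients and variables of \<open>f\<close> remains available.\<close>

lemma poly_mapping_induct_keys [case_names zero single add]:
  fixes f :: "'a \<Rightarrow>\<^sub>0 'b::comm_monoid_add"
  assumes "P 0"
    and "\<And>m. m \<in> Poly_Mapping.keys f \<Longrightarrow> P (Poly_Mapping.single m (Poly_Mapping.lookup f m))"
    and "\<And>g h. P g \<Longrightarrow> P h \<Longrightarrow> P (g + h)"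
  shows "P f"
proof -
  have "P (\<Sum>m\<in>M. Poly_Mapping.single m (Poly_Mapping.lookup f m))"
    if "M \<subseteq> Poly_Mapping.keys f" for M
    using finite_subset[OF that finite_keys] that
    by (induction M rule: finite_induct) (use assms in auto)
  then show ?thesis using poly_mapping_sum_single[of f] by (metis order_refl)
qed

definition mmon :: "('v \<Rightarrow> 'r::comm_ring_1) \<Rightarrow> ('v \<Rightarrow>\<^sub>0 nat) \<Rightarrow> 'r" where
  "mmon s m = (\<Prod>v\<in>Poly_Mapping.keys m. s v ^ Poly_Mapping.lookup m v)"

lemma mmon_superset:
  assumes "finite S" "Poly_Mapping.keys m \<subseteq> S"
  shows "mmon s m = (\<Prod>v\<in>S. s v ^ Poly_Mapping.lookup m v)"
  unfolding mmon_def using assms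
  by (intro prod.mono_neutral_left) (auto simp: not_in_keys_iff_lookup_eq_zero)

lemma mmon_0 [simp]: "mmon s 0 = 1"
  by (simp add: mmon_def)

lemma mmon_single [simp]: "mmon s (Poly_Mapping.single v n) = s v ^ n"
  by (cases "n = 0") (simp_all add: mmon_def)

lemma mmon_add: "mmon s (m + n) = mmon s m * mmon s n"
proof -
  let ?S = "Poly_Mapping.keys m \<union> Poly_Mapping.keys n"
  have "finite ?S" by simp
  then have "mmon s (m + n) = (\<Prod>v\<in>?S. s v ^ Poly_Mapping.lookup (m + n) v)"
    by (intro mmon_superset keys_add)
  also have "\<dots> = (\<Prod>v\<in>?S. s v ^ Poly_Mapping.lookup m v) * (\<Prod>v\<in>?S. s v ^ Poly_Mapping.lookup n v)"
    by (simp add: lookup_add power_add prod.distrib)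
  also have "\<dots> = mmon s m * mmon s n"
    using mmon_superset[OF \<open>finite ?S\<close>, of m s] mmon_superset[OF \<open>finite ?S\<close>, of n s] by simp
  finally show ?thesis .
qed

lemma mlin_mmon_mult:
  assumes "h 0 = 0" "\<And>a b. h (a + b) = h a + h b" "\<And>a b. h (a * b) = h a * h b"
  shows "mlin h (mmon s) (f * g) = mlin h (mmon s) f * mlin h (mmon s) g"
proof (induction f rule: poly_mapping_induct_keys)
  case (single m)
  show ?case
  proof (induction g rule: poly_mapping_induct_keys)
    case (single n)
    then show ?case by (simp add: mult_single mlin_single[of h, OF assms(1)] assms(3) mmon_add mult_ac)
  qed (simp_all add: distrib_left mlin_add[of h, OF assms(1,2)])
qed (simp_all add: distrib_right mlin_add[of h, OF assms(1,2)])

lemma mconst_0 [simp]: "mconst 0 = 0"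
  and mconst_1 [simp]: "mconst 1 = 1"
  and mconst_add: "mconst (a + b) = mconst a + mconst b"
  and mconst_mult: "mconst (c * d) = mconst c * mconst d"
  and mconst_uminus: "mconst (- e) = - mconst e"
  for a b :: "'a::monoid_add" and c d :: "'b::semiring_1" and e :: "'c::ab_group_add"
  by (simp_all add: mconst_def single_add mult_single single_uminus single_diff)

lemma lookup_mconst_mult:
  "Poly_Mapping.lookup (mconst c * f) m = (c::'k::comm_ring_1) * Poly_Mapping.lookup f m"
  unfolding mconst_def mult_map_scale_conv_mult[symmetric]
  by (simp add: Poly_Mapping.map.rep_eq when_def)

lemma mvar_power: "mvar v ^ n = Poly_Mapping.single (Poly_Mapping.single v n) (1::'k::comm_ring_1)"
proof (induction n)
  case (Suc n)
  have "Poly_Mapping.single v (1::nat) + Poly_Mapping.single v n = Poly_Mapping.single v (Suc n)"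
    by (simp flip: single_add)
  with Suc show ?case by (simp add: mvar_def mult_single)
qed simp

lemma monomial_induct [case_names zero add]:
  assumes "P 0" and "\<And>v m. v \<in> V \<Longrightarrow> P m \<Longrightarrow> P (Poly_Mapping.single v 1 + m)"
    and "Poly_Mapping.keys m \<subseteq> V"
  shows "P (m :: 'v \<Rightarrow>\<^sub>0 nat)"
proof -
  have step: "P (Poly_Mapping.single v n + m)" if "v \<in> V" "P m" for v n m
  proof (induction n)
    case (Suc n)
    have "Poly_Mapping.single v (Suc n) = Poly_Mapping.single v 1 + Poly_Mapping.single v n"
      by (simp flip: single_add)
    with assms(2)[OF that(1) Suc] show ?case by (simp add: add.assoc)
  qed (simp add: that)
  have "P (\<Sum>v\<in>W. Poly_Mapping.single v (Poly_Mapping.lookup m v))"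
    if "W \<subseteq> Poly_Mapping.keys m" for W
    using finite_subset[OF that finite_keys] that
    by (induction W rule: finite_induct) (use assms step in auto)
  then show ?thesis using poly_mapping_sum_single[of m] by (metis order_refl)
qed

lemma mvars_zero [simp]: "mvars 0 = {}"
  by (simp add: mvars_def)

lemma mvars_add: "mvars (f + g) \<subseteq> mvars f \<union> mvars g"
  using keys_add[of f g] unfolding mvars_def by blast

lemma mvars_uminus [simp]: "mvars (- f) = mvars (f :: ('v, 'k::ab_group_add) mpol)"
  unfolding mvars_def by (simp add: keys.rep_eq)

lemma mvars_diff: "mvars (f - g) \<subseteq> mvars f \<union> mvars (g :: ('v, 'k::ab_group_add) mpol)"
  using mvars_add[of f "- g"] by simp

lemma mvars_mult: "mvars (f * g) \<subseteq> mvars f \<union> mvars (g :: ('v, 'k::comm_ring_1) mpol)"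
proof
  fix v assume "v \<in> mvars (f * g)"
  then obtain m where m: "m \<in> Poly_Mapping.keys (f * g)" "v \<in> Poly_Mapping.keys m"
    by (auto simp: mvars_def)
  from m(1) obtain a b where "m = a + b" "a \<in> Poly_Mapping.keys f" "b \<in> Poly_Mapping.keys g"
    using keys_mult[of f g] by blast
  then show "v \<in> mvars f \<union> mvars g" using m(2) keys_add[of a b] by (auto simp: mvars_def)
qed

lemma mvars_mconst [simp]: "mvars (mconst c) = {}"
  by (simp add: mvars_def mconst_def)

lemma mvars_mvar [simp]: "mvars (mvar v :: ('v, 'k::comm_ring_1) mpol) = {v}"
  by (simp add: mvars_def mvar_def)

lemma type_subring_mvars: "type_subring {f :: ('v, 'k::comm_ring_1) mpol. mvars f \<subseteq> V}"
proof
  fix f g :: "('v, 'k) mpol" assume "f \<in> {f. mvars f \<subseteq> V}" "g \<in> {f. mvars f \<subseteq> V}"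
  then show "f + g \<in> {f. mvars f \<subseteq> V}" "f * g \<in> {f. mvars f \<subseteq> V}"
    using mvars_add[of f g] mvars_mult[of f g] by blast+
qed (auto simp: mvars_def)

lemma type_subring_mpol:
  fixes D :: "'k::field set"
  assumes "type_subring D"
  shows "type_subring (carrier (mpol_ring D (V :: 'v set)))"
proof -
  interpret type_subring D by fact
  interpret M: type_subring "{f :: ('v, 'k) mpol. mvars f \<subseteq> V}" by (rule type_subring_mvars)
  have eq: "carrier (mpol_ring D V) = {f. (\<forall>m. Poly_Mapping.lookup f m \<in> D)} \<inter> {f. mvars f \<subseteq> V}"
    by (auto simp: mpol_ring_def)
  have mult: "Poly_Mapping.lookup (f * g) m \<in> D"
    if "\<And>m. Poly_Mapping.lookup f m \<in> D" "\<And>m. Poly_Mapping.lookup g m \<in> D"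
    for f g :: "('v, 'k) mpol" and m
  proof (induction f arbitrary: m rule: poly_mapping_induct_keys)
    case (single a)
    show ?case
    proof (induction g arbitrary: m rule: poly_mapping_induct_keys)
      case (single b)
      then show ?case using that mult_closed zero_closed
        by (auto simp: mult_single lookup_single when_def)
    qed (use zero_closed add_closed in \<open>simp_all add: distrib_left lookup_add\<close>)
  qed (use zero_closed add_closed in \<open>simp_all add: distrib_right lookup_add\<close>)
  show ?thesis unfolding eq
    using mult M.one_closed M.add_closed M.mult_closed M.uminus_closed
      one_closed zero_closed add_closed uminus_closed
    by unfold_locales (simp_all add: lookup_one lookup_add when_def)
qed

lemma mconst_in_mpol_ring: "d \<in> D \<Longrightarrow> 0 \<in> D \<Longrightarrow> mconst d \<in> carrier (mpol_ring D V)"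
  unfolding mpol_ring_def by (simp add: mconst_def mvars_def lookup_single when_def)

lemma mvar_in_mpol_ring: "v \<in> V \<Longrightarrow> 0 \<in> D \<Longrightarrow> 1 \<in> D \<Longrightarrow> mvar v \<in> carrier (mpol_ring D V)"
  unfolding mpol_ring_def by (simp add: mvar_def mvars_def lookup_single when_def)

text \<open>Monomials are built up by one variable at a time, because stability under a single
  variable is what can be proved for spans modulo the relations.\<close>

lemma mpol_ring_induct [consumes 2, case_names const var add]:
  assumes f: "f \<in> carrier (mpol_ring D V)" and "0 \<in> D"
    and const: "\<And>d. d \<in> D \<Longrightarrow> P (mconst d)"
    and var: "\<And>v f. v \<in> V \<Longrightarrow> P f \<Longrightarrow> P (mvar v * f)"
    and add: "\<And>f g. P f \<Longrightarrow> P g \<Longrightarrow> P (f + g)"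
  shows "P f"
proof -
  have P: "P (Poly_Mapping.single m d)" if "Poly_Mapping.keys m \<subseteq> V" "d \<in> D" for m d
  proof (rule monomial_induct[where V = V and P = "\<lambda>m. P (Poly_Mapping.single m d)"])
    show "P (Poly_Mapping.single 0 d)" using const[OF that(2)] by (simp add: mconst_def)
    fix v m assume "v \<in> V" "P (Poly_Mapping.single m d)"
    then have "P (mvar v * Poly_Mapping.single m d)" by (rule var)
    then show "P (Poly_Mapping.single (Poly_Mapping.single v 1 + m) d)"
      by (simp add: mvar_def mult_single)
  qed (rule that(1))
  show ?thesis
  proof (induction f rule: poly_mapping_induct_keys)
    case zero
    show ?case using const[OF \<open>0 \<in> D\<close>] by simp
  next
    case (single m)
    then have "Poly_Mapping.keys m \<subseteq> V" "Poly_Mapping.lookup f m \<in> D"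
      using f by (auto simp: mpol_ring_def mvars_def)
    then show ?case by (rule P)
  qed (rule add)
qed

section \<open>Evaluation and substitution homomorphisms\<close>

lemma meval_eq_mlin: "meval x f = mlin id (mmon x) f"
  by (simp add: meval_def mlin_def mmon_def)

lemma meval_add: "meval x (f + g) = meval x f + meval x (g :: ('v, 'k::comm_ring_1) mpol)"
  unfolding meval_eq_mlin by (rule mlin_add) auto

lemma meval_mult: "meval x (f * g) = meval x f * meval x (g :: ('v, 'k::comm_ring_1) mpol)"
  unfolding meval_eq_mlin by (rule mlin_mmon_mult) auto

lemma meval_mconst [simp]: "meval x (mconst c) = (c :: 'k::comm_ring_1)"
  unfolding meval_eq_mlin mconst_def by (simp add: mlin_single)

lemma meval_mvar [simp]: "meval x (mvar v) = (x v :: 'k::comm_ring_1)"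
  unfolding meval_eq_mlin mvar_def by (simp add: mlin_single)

lemma meval_0 [simp]: "meval x 0 = 0"
  by (simp add: meval_def)

lemma meval_1 [simp]: "meval x 1 = (1 :: 'k::comm_ring_1)"
  using meval_mconst[of x 1] by simp

lemma meval_uminus: "meval x (- f) = - meval x (f :: ('v, 'k::comm_ring_1) mpol)"
  using meval_add[of x f "- f"] by (simp add: eq_neg_iff_add_eq_0 add.commute)

lemma meval_diff: "meval x (f - g) = meval x f - meval x (g :: ('v, 'k::comm_ring_1) mpol)"
  using meval_add[of x f "- g"] by (simp add: meval_uminus)

lemma meval_power: "meval x (f ^ n) = meval x (f :: ('v, 'k::comm_ring_1) mpol) ^ n"
  by (induction n) (simp_all add: meval_mult)

lemma meval_sum: "meval x (sum f A) = (\<Sum>a\<in>A. meval x (f a :: ('v, 'k::comm_ring_1) mpol))"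
  by (induction A rule: infinite_finite_induct) (simp_all add: meval_add)

lemma meval_cong: "(\<And>v. v \<in> mvars f \<Longrightarrow> x v = y v) \<Longrightarrow> meval x f = meval y f"
  unfolding meval_def mvars_def
  by (intro sum.cong prod.cong arg_cong2[where f = "(*)"]) (auto intro!: arg_cong2[where f = "(^)"])

text \<open>With the images of the generators for \<open>s\<close>, this becomes the homomorphism of
  the theorem. It is linear over all of \<open>'k\<close>, so \<open>D\<close> enters only when it
  is restricted.\<close>

definition msubst :: "('v \<Rightarrow> ('w, 'k) mpol) \<Rightarrow> ('v, 'k) mpol \<Rightarrow> ('w, 'k::comm_ring_1) mpol" where
  "msubst s = mlin mconst (mmon s)"

lemma msubst_add: "msubst s (f + g) = msubst s f + msubst s g"
  unfolding msubst_def by (rule mlin_add) (simp_all add: mconst_add)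

lemma msubst_mult: "msubst s (f * g) = msubst s f * msubst s g"
  unfolding msubst_def by (rule mlin_mmon_mult) (simp_all add: mconst_add mconst_mult)

lemma msubst_mconst [simp]: "msubst s (mconst c) = mconst c"
  unfolding msubst_def by (simp add: mconst_def mlin_single)

lemma msubst_mvar [simp]: "msubst s (mvar v) = s v"
  unfolding msubst_def mvar_def by (simp add: mlin_single)

lemma msubst_1 [simp]: "msubst s 1 = 1"
  using msubst_mconst[of s 1] by simp

lemma msubst_0 [simp]: "msubst s 0 = 0"
  using msubst_mconst[of s 0] by simp

lemma msubst_uminus: "msubst s (- f) = - msubst s f"
  using msubst_add[of s f "- f"] by (simp add: eq_neg_iff_add_eq_0 add.commute)

lemma msubst_diff: "msubst s (f - g) = msubst s f - msubst s g"
  using msubst_add[of s f "- g"] by (simp add: msubst_uminus)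

lemma msubst_power: "msubst s (f ^ n) = msubst s f ^ n"
  by (induction n) (simp_all add: msubst_mult)

lemma msubst_prod: "msubst s (prod f A) = (\<Prod>a\<in>A. msubst s (f a))"
  by (induction A rule: infinite_finite_induct) (simp_all add: msubst_mult)

lemma msubst_sum: "msubst s (sum f A) = (\<Sum>a\<in>A. msubst s (f a))"
  by (induction A rule: infinite_finite_induct) (simp_all add: msubst_add)

lemma poly_at_var_pCons: "poly_at_var (pCons c p) v = mconst c + mvar v * poly_at_var p v"
  unfolding poly_at_var_def by (cases "c = 0 \<and> p = 0") (auto simp: map_poly_pCons)

lemma poly_at_var_0 [simp]: "poly_at_var 0 v = 0"
  by (simp add: poly_at_var_def)

lemma poly_at_var_add: "poly_at_var (p + q) v = poly_at_var p v + poly_at_var q v"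
  by (induction p q rule: poly_induct2) (simp_all add: poly_at_var_pCons mconst_add algebra_simps)

lemma poly_at_var_smult: "poly_at_var (Polynomial.smult c p) v = mconst c * poly_at_var p v"
  by (induction p) (simp_all add: poly_at_var_pCons mconst_mult algebra_simps)

lemma poly_at_var_mult: "poly_at_var (p * q) v = poly_at_var p v * poly_at_var q v"
  by (induction p)
    (simp_all add: poly_at_var_pCons poly_at_var_add poly_at_var_smult distrib_right mult.assoc)

lemma poly_at_var_1 [simp]: "poly_at_var 1 v = 1"
  using poly_at_var_pCons[of 1 0 v] by (simp add: one_pCons)

lemma poly_at_var_X [simp]: "poly_at_var [:0, 1:] v = mvar v"
  by (simp add: poly_at_var_pCons)

lemma poly_at_var_diff: "poly_at_var (p - q) v = poly_at_var p v - poly_at_var q v"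
  using poly_at_var_add[of "p - q" q v] by simp

lemma poly_at_var_power: "poly_at_var (p ^ n) v = poly_at_var p v ^ n"
  by (induction n) (simp_all add: poly_at_var_mult)

lemma meval_poly_at_var: "meval x (poly_at_var p v) = poly p (x v)"
  by (induction p) (simp_all add: poly_at_var_pCons meval_add meval_mult)

lemma mvars_poly_at_var: "mvars (poly_at_var p v) \<subseteq> {v}"
proof (induction p)
  case (pCons c p)
  then show ?case
    using mvars_add[of "mconst c" "mvar v * poly_at_var p v"] mvars_mult[of "mvar v" "poly_at_var p v"]
    by (auto simp: poly_at_var_pCons)
qed simp

lemma poly_at_var_altdef:
  assumes "Polynomial.degree p < n"
  shows "poly_at_var p v = (\<Sum>i<n. mconst (Polynomial.coeff p i) * mvar v ^ i)"
  using assms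
proof (induction p arbitrary: n)
  case (pCons c p)
  show ?case
  proof (cases "p = 0")
    case True
    obtain m where "n = Suc m" using pCons.prems by (cases n) auto
    with True show ?thesis
      by (simp add: poly_at_var_pCons sum.lessThan_Suc_shift coeff_pCons del: sum.lessThan_Suc)
  next
    case False
    obtain m where m: "n = Suc m" using pCons.prems by (cases n) auto
    then have "Polynomial.degree p < m" using pCons.prems False by simp
    then show ?thesis unfolding m
      by (simp add: poly_at_var_pCons pCons.IH[of m] sum.lessThan_Suc_shift sum_distrib_left
          mult.left_commute coeff_pCons del: sum.lessThan_Suc)
  qed
qed simp

section \<open>Leading monomials and digit products\<close>

definition mdeg :: "('v \<Rightarrow>\<^sub>0 nat) \<Rightarrow> nat" where
  "mdeg m = (\<Sum>v\<in>Poly_Mapping.keys m. Poly_Mapping.lookup m v)"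

lemma mdeg_add: "mdeg (m + n) = mdeg m + mdeg n"
proof -
  let ?S = "Poly_Mapping.keys m \<union> Poly_Mapping.keys n"
  have *: "mdeg k = (\<Sum>v\<in>?S. Poly_Mapping.lookup k v)" if "Poly_Mapping.keys k \<subseteq> ?S" for k
    unfolding mdeg_def using that
    by (intro sum.mono_neutral_left) (auto simp: not_in_keys_iff_lookup_eq_zero)
  show ?thesis
    using *[of m] *[of n] *[OF keys_add] by (simp add: lookup_add sum.distrib)
qed

lemma mdeg_single [simp]: "mdeg (Poly_Mapping.single v n) = n"
  by (cases "n = 0") (simp_all add: mdeg_def)

text \<open>Requiring strictly smaller total degree of all other terms avoids choosing a monomial
  order and is stable under products.\<close>

definition has_lead :: "('v, 'k::comm_ring_1) mpol \<Rightarrow> ('v \<Rightarrow>\<^sub>0 nat) \<Rightarrow> 'k \<Rightarrow> bool" where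
  "has_lead f m c \<longleftrightarrow>
     (\<exists>r. f = Poly_Mapping.single m c + r \<and> (\<forall>n\<in>Poly_Mapping.keys r. mdeg n < mdeg m))"

lemma has_lead_one: "has_lead 1 0 1"
  unfolding has_lead_def by (intro exI[of _ 0]) simp

lemma has_lead_mult:
  assumes "has_lead f m c" "has_lead g n d"
  shows "has_lead (f * g) (m + n) (c * d)"
proof -
  obtain r where r: "f = Poly_Mapping.single m c + r" "\<And>k. k \<in> Poly_Mapping.keys r \<Longrightarrow> mdeg k < mdeg m"
    using assms(1) by (auto simp: has_lead_def)
  obtain t where t: "g = Poly_Mapping.single n d + t" "\<And>k. k \<in> Poly_Mapping.keys t \<Longrightarrow> mdeg k < mdeg n"
    using assms(2) by (auto simp: has_lead_def)
  define u where "u = Poly_Mapping.single m c * t + r * Poly_Mapping.single n d + r * t"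
  have "f * g = Poly_Mapping.single (m + n) (c * d) + u"
    unfolding r(1) t(1) u_def by (simp add: algebra_simps mult_single)
  moreover have "mdeg k < mdeg (m + n)" if k: "k \<in> Poly_Mapping.keys u" for k
  proof -
    consider "k \<in> Poly_Mapping.keys (Poly_Mapping.single m c * t)"
      | "k \<in> Poly_Mapping.keys (r * Poly_Mapping.single n d)" | "k \<in> Poly_Mapping.keys (r * t)"
      using k keys_add[of "Poly_Mapping.single m c * t + r * Poly_Mapping.single n d" "r * t"]
        keys_add[of "Poly_Mapping.single m c * t" "r * Poly_Mapping.single n d"]
      unfolding u_def by blast
    then show ?thesis
    proof cases
      case 1
      then obtain a b where "k = a + b" "a \<in> Poly_Mapping.keys (Poly_Mapping.single m c)"
          "b \<in> Poly_Mapping.keys t"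
        using keys_mult[of "Poly_Mapping.single m c" t] by blast
      then show ?thesis using t(2)[of b] by (simp add: mdeg_add split: if_splits)
    next
      case 2
      then obtain a b where "k = a + b" "a \<in> Poly_Mapping.keys r"
          "b \<in> Poly_Mapping.keys (Poly_Mapping.single n d)"
        using keys_mult[of r "Poly_Mapping.single n d"] by blast
      then show ?thesis using r(2)[of a] by (simp add: mdeg_add split: if_splits)
    next
      case 3
      then obtain a b where "k = a + b" "a \<in> Poly_Mapping.keys r" "b \<in> Poly_Mapping.keys t"
        using keys_mult[of r t] by blast
      then show ?thesis using r(2)[of a] t(2)[of b] by (simp add: mdeg_add)
    qed
  qed
  ultimately show ?thesis unfolding has_lead_def by blast
qed

lemma has_lead_prod:
  assumes "\<And>a. a \<in> A \<Longrightarrow> has_lead (f a) (m a) (c a)"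
  shows "has_lead (prod f A) (sum m A) (prod c A)"
  using assms
  by (induction A rule: infinite_finite_induct) (auto intro: has_lead_one has_lead_mult)

lemma has_lead_poly_at_var:
  "has_lead (poly_at_var p v) (Poly_Mapping.single v (Polynomial.degree p)) (lead_coeff p)"
proof -
  let ?n = "Polynomial.degree p"
  define r where "r = (\<Sum>i<?n. mconst (Polynomial.coeff p i) * mvar v ^ i)"
  have single: "mconst c * mvar v ^ i = Poly_Mapping.single (Poly_Mapping.single v i) c" for c :: 'b and i
    by (simp add: mvar_power mconst_def mult_single)
  have "poly_at_var p v = Poly_Mapping.single (Poly_Mapping.single v ?n) (lead_coeff p) + r"
    by (subst poly_at_var_altdef[of p "Suc ?n"]) (simp_all add: r_def single)
  moreover have "mdeg k < ?n" if "k \<in> Poly_Mapping.keys r" for k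
  proof -
    from that obtain i where "i < ?n" "k \<in> Poly_Mapping.keys (mconst (Polynomial.coeff p i) * mvar v ^ i)"
      using keys_sum[of "\<lambda>i. mconst (Polynomial.coeff p i) * mvar v ^ i" "{..<?n}"]
      unfolding r_def by blast
    then show ?thesis unfolding single by (auto split: if_splits)
  qed
  ultimately show ?thesis unfolding has_lead_def by auto
qed

text \<open>Among the keys of \<open>f\<close> choose \<open>m\<close> of maximal total degree. No
  \<open>b n\<close> with another key \<open>n\<close> contains the monomial \<open>m\<close>, so
  the coefficient there is that of \<open>f\<close> times a nonzero constant.\<close>

lemma mlin_eq_0_imp_eq_0:
  fixes b :: "('v \<Rightarrow>\<^sub>0 nat) \<Rightarrow> ('v, 'k::field) mpol"
  assumes lead: "\<And>m. m \<in> Poly_Mapping.keys f \<Longrightarrow> \<exists>c. c \<noteq> 0 \<and> has_lead (b m) m c"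
    and zero: "mlin mconst b f = 0"
  shows "f = 0"
proof (rule ccontr)
  let ?K = "Poly_Mapping.keys f"
  assume "f \<noteq> 0"
  then have "?K \<noteq> {}" by simp
  then obtain m where m: "m \<in> ?K" "\<And>n. n \<in> ?K \<Longrightarrow> mdeg n \<le> mdeg m"
    using finite_imageI[OF finite_keys, of mdeg f] Max_in[of "mdeg ` ?K"] Max_ge[of "mdeg ` ?K"]
    by (metis (no_types, lifting) imageE image_eqI image_is_empty)
  obtain c where c: "c \<noteq> 0" "has_lead (b m) m c" using lead[OF m(1)] by blast
  have lookup: "Poly_Mapping.lookup (b n) m = (if n = m then c else 0)" if n: "n \<in> ?K" for n
  proof -
    obtain e r where er: "b n = Poly_Mapping.single n e + r" "\<And>k. k \<in> Poly_Mapping.keys r \<Longrightarrow> mdeg k < mdeg n"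
        "n = m \<Longrightarrow> e = c"
      using lead[OF n] c(2) unfolding has_lead_def by metis
    have "m \<notin> Poly_Mapping.keys r" using er(2)[of m] m(2)[OF n] by auto
    then have "Poly_Mapping.lookup r m = 0" by (simp add: in_keys_iff)
    then show ?thesis using er by (auto simp: lookup_add lookup_single when_def)
  qed
  have "0 = Poly_Mapping.lookup (mlin mconst b f) m" by (simp add: zero)
  also have "\<dots> = (\<Sum>n\<in>?K. Poly_Mapping.lookup f n * Poly_Mapping.lookup (b n) m)"
    by (simp add: mlin_def lookup_sum lookup_mconst_mult)
  also have "\<dots> = (\<Sum>n\<in>?K. if n = m then Poly_Mapping.lookup f n * c else 0)"
    by (rule sum.cong) (auto simp: lookup)
  also have "\<dots> = Poly_Mapping.lookup f m * c" using m(1) by simp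
  finally show False using c(1) m(1) by (simp add: in_keys_iff)
qed

text \<open>For base \<open>q\<close> digits \<open>n_0, n_1, ...\<close> of \<open>n\<close>, this
  is the product of the powers \<open>y (k + j) ^ n_j\<close>. The offset \<open>k\<close> lets
  inductions pass to \<open>n div q\<close>.\<close>

function digit_prod :: "nat \<Rightarrow> (nat \<Rightarrow> 'r::comm_ring_1) \<Rightarrow> nat \<Rightarrow> nat \<Rightarrow> 'r" where
  "digit_prod q y k n =
     (if q \<le> 1 \<or> n = 0 then 1 else y k ^ (n mod q) * digit_prod q y (Suc k) (n div q))"
  by auto
termination by (relation "Wellfounded.measure (\<lambda>(_, _, _, n). n)") auto

declare digit_prod.simps [simp del]

lemma digit_prod_0 [simp]: "digit_prod q y k 0 = 1"
  by (simp add: digit_prod.simps[of q y k 0])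

lemma digit_prod_rec:
  "q > 1 \<Longrightarrow> digit_prod q y k n = y k ^ (n mod q) * digit_prod q y (Suc k) (n div q)"
  using digit_prod.simps[of q y k n] by (cases "n = 0") simp_all

lemma digit_prod_shift:
  assumes "r < q" "q > 1"
  shows "y k ^ r * digit_prod q y (Suc k) n = digit_prod q y k (r + q * n)"
  using assms by (simp add: digit_prod_rec[of q y k "r + q * n"])

lemma digit_prod_induct:
  assumes "P 1" "\<And>k. P (y k)" "\<And>a b. P a \<Longrightarrow> P b \<Longrightarrow> P (a * b)"
  shows "P (digit_prod q y k n)"
proof (induction n arbitrary: k rule: less_induct)
  case (less n)
  have pow: "P (y k ^ e)" for e by (induction e) (use assms in auto)
  show ?case
  proof (cases "q > 1 \<and> n > 0")
    case True
    then show ?thesis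
      using less.IH[of "n div q" "Suc k"] pow assms(3) by (simp add: digit_prod_rec[of q y k n])
  next
    case False
    then have "digit_prod q y k n = 1" using digit_prod.simps[of q y k n] by auto
    then show ?thesis using assms(1) by simp
  qed
qed

lemma digit_prod_hom:
  assumes "h 1 = 1" "\<And>a b. h (a * b) = h a * h b"
  shows "h (digit_prod q y k n) = digit_prod q (\<lambda>k. h (y k)) k n"
proof (induction n arbitrary: k rule: less_induct)
  case (less n)
  have pow: "h (y k ^ e) = h (y k) ^ e" for e by (induction e) (simp_all add: assms)
  show ?case
  proof (cases "q > 1 \<and> n > 0")
    case True
    then show ?thesis
      using less.IH[of "n div q" "Suc k"] pow
      by (simp add: digit_prod_rec[of q y k n] digit_prod_rec[of q "\<lambda>k. h (y k)" k n] assms(2))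
  next
    case False
    then show ?thesis
      using digit_prod.simps[of q y k n] digit_prod.simps[of q "\<lambda>k. h (y k)" k n] assms(1) by auto
  qed
qed

section \<open>Iterates of \<open>F_poly\<close> and their digit products\<close>

lemma poly_iterate_0 [simp]: "poly_iterate 0 f = [:0, 1:]"
  by (simp add: poly_iterate_def)

lemma pcompose_F_poly: "pcompose (F_poly \<pi> q) p = Polynomial.smult (1 / \<pi> q) (p ^ q - p)"
proof -
  have "pcompose ([:0, 1:] ^ q) p = p ^ q"
    by (induction q) (simp_all add: pcompose_mult pcompose_pCons pcompose_1)
  then show ?thesis by (simp add: F_poly_def pcompose_smult pcompose_diff pcompose_pCons)
qed

text \<open>The new copy of \<open>F_poly\<close> is composed on the outside. After multiplication
  by \<open>\<pi> q\<close> this is the relation imposed on the generators.\<close>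

lemma poly_iterate_Suc:
  "poly_iterate (Suc k) (F_poly \<pi> q) =
     Polynomial.smult (1 / \<pi> q) (poly_iterate k (F_poly \<pi> q) ^ q - poly_iterate k (F_poly \<pi> q))"
  by (simp add: poly_iterate_def pcompose_F_poly)

lemma poly_iterate_int_valued:
  assumes "f \<in> int_valued D" "x \<in> D"
  shows "poly (poly_iterate k f) x \<in> D"
  by (induction k) (use assms in \<open>auto simp: poly_iterate_def poly_pcompose int_valued_def\<close>)

lemma degree_poly_iterate:
  assumes "\<pi> q \<noteq> 0" "q > 1"
  shows "Polynomial.degree (poly_iterate k (F_poly \<pi> q)) = q ^ k"
    and "lead_coeff (poly_iterate (Suc k) (F_poly \<pi> q)) =
           lead_coeff (poly_iterate k (F_poly \<pi> q)) ^ q / \<pi> q"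
proof -
  have step: "Polynomial.degree (Polynomial.smult (1 / \<pi> q) (p ^ q - p)) = q * Polynomial.degree p \<and>
      lead_coeff (Polynomial.smult (1 / \<pi> q) (p ^ q - p)) = lead_coeff p ^ q / \<pi> q"
    if "Polynomial.degree p > 0" for p :: "'a poly"
  proof -
    have deg: "Polynomial.degree (p ^ q) = q * Polynomial.degree p"
      using that by (intro degree_power_eq) auto
    have less: "Polynomial.degree p < Polynomial.degree (p ^ q)" using that assms(2) deg by simp
    then have "Polynomial.degree (p ^ q - p) = q * Polynomial.degree p"
      using degree_add_eq_left[of "- p" "p ^ q"] deg by simp
    moreover have "Polynomial.coeff p (q * Polynomial.degree p) = 0"
      using less deg by (intro coeff_eq_0) simp
    moreover have "Polynomial.coeff (p ^ q) (q * Polynomial.degree p) = lead_coeff p ^ q"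
      using lead_coeff_power[of p q] deg by simp
    ultimately show ?thesis using assms(1) by simp
  qed
  show deg: "Polynomial.degree (poly_iterate k (F_poly \<pi> q)) = q ^ k" for k
  proof (induction k)
    case (Suc k)
    then show ?case using step[of "poly_iterate k (F_poly \<pi> q)"] assms(2) by (simp add: poly_iterate_Suc)
  qed simp
  show "lead_coeff (poly_iterate (Suc k) (F_poly \<pi> q)) =
           lead_coeff (poly_iterate k (F_poly \<pi> q)) ^ q / \<pi> q"
    unfolding poly_iterate_Suc
    by (rule step[THEN conjunct2]) (use deg[of k] assms(2) in simp)
qed

text \<open>The degree \<open>q ^ k\<close> of the iterates turns the digit expansion back into
  \<open>n\<close>. Passing from level \<open>k\<close> to \<open>Suc k\<close> costs one division
  by \<open>\<pi> q\<close> for each of the \<open>n div q\<close> units in the higher digits, which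
  is the recursion of \<open>legendre_exp\<close>.\<close>

lemma digit_prod_poly_iterate:
  fixes \<pi> :: "nat \<Rightarrow> 'k::field"
  assumes "\<pi> q \<noteq> 0" "q > 1"
  defines "P \<equiv> \<lambda>k. poly_iterate k (F_poly \<pi> q)"
  shows "Polynomial.degree (digit_prod q P k n) = n * q ^ k"
    and "lead_coeff (digit_prod q P k n) = lead_coeff (P k) ^ n / \<pi> q ^ legendre_exp q n"
proof -
  have deg: "Polynomial.degree (P k) = q ^ k" for k
    unfolding P_def using degree_poly_iterate(1) assms by blast
  have lead: "lead_coeff (P (Suc k)) = lead_coeff (P k) ^ q / \<pi> q" for k
    unfolding P_def using degree_poly_iterate(2) assms by blast
  have nz: "P k \<noteq> 0" for k using deg[of k] assms(2) by auto
  have "Polynomial.degree (digit_prod q P k n) = n * q ^ k \<and>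
      lead_coeff (digit_prod q P k n) = lead_coeff (P k) ^ n / \<pi> q ^ legendre_exp q n \<and>
      digit_prod q P k n \<noteq> 0"
  proof (induction n arbitrary: k rule: less_induct)
    case (less n)
    show ?case
    proof (cases "n = 0")
      case False
      let ?r = "n mod q" and ?m = "n div q"
      note rec = digit_prod_rec[OF assms(2), of P k n]
      have "?m < n" using False assms(2) by simp
      note IH = less.IH[OF this, of "Suc k"]
      have nz': "P k ^ ?r \<noteq> 0" using nz by simp
      have n: "n = ?r + q * ?m" by simp
      have "Polynomial.degree (digit_prod q P k n) = ?r * q ^ k + ?m * q ^ Suc k"
        unfolding rec using IH nz' by (simp add: degree_mult_eq degree_power_eq nz deg)
      also have "\<dots> = (?r + q * ?m) * q ^ k" unfolding power_Suc
        by (simp only: distrib_left distrib_right mult_ac)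
      finally have 1: "Polynomial.degree (digit_prod q P k n) = n * q ^ k" unfolding n[symmetric] .
      have "lead_coeff (digit_prod q P k n) =
          lead_coeff (P k) ^ ?r * (lead_coeff (P (Suc k)) ^ ?m / \<pi> q ^ legendre_exp q ?m)"
        by (simp only: rec lead_coeff_mult lead_coeff_power IH[THEN conjunct2, THEN conjunct1])
      also have "\<dots> = lead_coeff (P k) ^ (?r + q * ?m) / \<pi> q ^ (?m + legendre_exp q ?m)"
        unfolding lead power_divide power_add[of "lead_coeff (P k)"] power_mult power_add by simp
      also have "\<dots> = lead_coeff (P k) ^ n / \<pi> q ^ legendre_exp q n"
        using legendre_exp_rec[OF assms(2), of n] by simp
      finally have 2: "lead_coeff (digit_prod q P k n) = lead_coeff (P k) ^ n / \<pi> q ^ legendre_exp q n" .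
      have "digit_prod q P k n \<noteq> 0" unfolding rec using IH nz' by simp
      with 1 2 show ?thesis by blast
    qed simp
  qed
  then show "Polynomial.degree (digit_prod q P k n) = n * q ^ k"
    "lead_coeff (digit_prod q P k n) = lead_coeff (P k) ^ n / \<pi> q ^ legendre_exp q n" by blast+
qed

section \<open>The ideal of relations\<close>

lemma mpol_ring_eq_ring_on: "mpol_ring D V = ring_on (carrier (mpol_ring D V))"
  by (simp add: mpol_ring_def)

locale presentation = class_C_domain D \<pi> for D :: "'k::field set" and \<pi> :: "nat \<Rightarrow> 'k" +
  fixes I :: "'i set"
begin

abbreviation A :: "('i gen_var, 'k) mpol ring" where
  "A \<equiv> mpol_ring D (gen_vars I)"

abbreviation J :: "('i gen_var, 'k) mpol set" where
  "J \<equiv> Idl\<^bsub>A\<^esub> (relators \<pi> I)"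

definition gen_image :: "'i gen_var \<Rightarrow> ('i, 'k) mpol" where
  "gen_image v =
     (case v of Base i \<Rightarrow> mvar i | Iter i q k \<Rightarrow> poly_at_var (poly_iterate k (F_poly \<pi> q)) i)"

abbreviation \<phi> :: "('i gen_var, 'k) mpol \<Rightarrow> ('i, 'k) mpol" where
  "\<phi> \<equiv> msubst gen_image"

sublocale A: type_subring "carrier A"
  by (rule type_subring_mpol) (rule type_subring_axioms)

lemma cring_A: "cring A"
  using A.cring_ring_on by (simp flip: mpol_ring_eq_ring_on)

lemma ideal_A_iff:
  "ideal L A \<longleftrightarrow>
     L \<subseteq> carrier A \<and> 0 \<in> L \<and> (\<forall>x\<in>L. \<forall>y\<in>L. x + y \<in> L) \<and> (\<forall>x\<in>carrier A. \<forall>y\<in>L. x * y \<in> L)"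
  using A.ideal_iff[of L] by (simp flip: mpol_ring_eq_ring_on)

lemma mconst_in_A: "d \<in> D \<Longrightarrow> mconst d \<in> carrier A"
  by (intro mconst_in_mpol_ring zero_closed)

lemma Base_in_A: "i \<in> I \<Longrightarrow> mvar (Base i) \<in> carrier A"
  by (intro mvar_in_mpol_ring zero_closed one_closed) (auto simp: gen_vars_def)

lemma Iter_in_A: "i \<in> I \<Longrightarrow> primepow q \<Longrightarrow> mvar (Iter i q k) \<in> carrier A"
  by (intro mvar_in_mpol_ring zero_closed one_closed) (auto simp: gen_vars_def)

lemma relators_subset: "relators \<pi> I \<subseteq> carrier A"
  unfolding relators_def
  by (auto intro!: A.diff_closed A.mult_closed A.power_closed mconst_in_A Base_in_A Iter_in_A
      generator_closed)

lemma ideal_J: "ideal J A"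
  using ring.genideal_ideal[OF cring.axioms(1)[OF cring_A] relators_subset] .

lemma J_subset: "x \<in> J \<Longrightarrow> x \<in> carrier A"
  and J_zero: "0 \<in> J"
  and J_add: "x \<in> J \<Longrightarrow> y \<in> J \<Longrightarrow> x + y \<in> J"
  and J_mult: "a \<in> carrier A \<Longrightarrow> x \<in> J \<Longrightarrow> a * x \<in> J"
  using ideal_J unfolding ideal_A_iff by blast+

lemma relators_subset_J: "relators \<pi> I \<subseteq> J"
  using ring.genideal_self[OF cring.axioms(1)[OF cring_A] relators_subset] .

lemma relator_base: "i \<in> I \<Longrightarrow> primepow q \<Longrightarrow> mvar (Iter i q 0) - mvar (Base i) \<in> J"
  using relators_subset_J by (rule subsetD) (auto simp: relators_def)

lemma relator_step:
  "i \<in> I \<Longrightarrow> primepow q \<Longrightarrow>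
     mvar (Iter i q k) ^ q - mvar (Iter i q k) - mconst (\<pi> q) * mvar (Iter i q (Suc k)) \<in> J"
  using relators_subset_J by (rule subsetD) (unfold relators_def, blast)

text \<open>The \<open>D\<close>-submodule generated by \<open>J\<close> and the \<open>b m\<close>
  with \<open>m \<in> M\<close>, that is, the span modulo the relations.\<close>

inductive_set jspan :: "'m set \<Rightarrow> ('m \<Rightarrow> ('i gen_var, 'k) mpol) \<Rightarrow> ('i gen_var, 'k) mpol set"
  for M b where
  jspan_J: "x \<in> J \<Longrightarrow> x \<in> jspan M b"
| jspan_base: "m \<in> M \<Longrightarrow> d \<in> D \<Longrightarrow> mconst d * b m \<in> jspan M b"
| jspan_add: "x \<in> jspan M b \<Longrightarrow> y \<in> jspan M b \<Longrightarrow> x + y \<in> jspan M b"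

lemma jspan_scale:
  assumes "x \<in> jspan M b" "d \<in> D"
  shows "mconst d * x \<in> jspan M b"
  using assms(1)
proof (induction rule: jspan.induct)
  case (jspan_base m e)
  have "mconst (d * e) * b m \<in> jspan M b"
    by (rule jspan.jspan_base) (use jspan_base assms(2) mult_closed in auto)
  then show ?case by (simp add: mconst_mult mult.assoc)
qed (use assms(2) in \<open>auto simp: distrib_left intro: jspan.intros J_mult mconst_in_A\<close>)

lemma jspan_gen: "m \<in> M \<Longrightarrow> b m \<in> jspan M b"
  using jspan_base[of m M 1 b] one_closed by simp

lemma jspan_mult_into:
  assumes x: "x \<in> jspan M b" and y: "y \<in> carrier A"
    and b: "\<And>m. m \<in> M \<Longrightarrow> y * b m \<in> jspan M' b'"
  shows "y * x \<in> jspan M' b'"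
  using x
proof (induction rule: jspan.induct)
  case (jspan_base m d)
  have "mconst d * (y * b m) \<in> jspan M' b'" using jspan_scale b jspan_base by blast
  then show ?case by (simp add: mult.left_commute)
qed (use y in \<open>auto simp: distrib_left intro: jspan.intros J_mult\<close>)

lemma jspan_representation:
  assumes "x \<in> jspan M b"
  shows "\<exists>c. Poly_Mapping.keys c \<subseteq> M \<and> x - mlin mconst b c \<in> J"
  using assms
proof (induction rule: jspan.induct)
  case (jspan_J x)
  then show ?case by (intro exI[of _ 0]) simp
next
  case (jspan_base m d)
  then show ?case
    by (intro exI[of _ "Poly_Mapping.single m d"]) (simp add: mlin_single J_zero)
next
  case (jspan_add x y)
  then obtain c d where *: "Poly_Mapping.keys c \<subseteq> M" "x - mlin mconst b c \<in> J"
      "Poly_Mapping.keys d \<subseteq> M" "y - mlin mconst b d \<in> J" by blast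
  have "x + y - mlin mconst b (c + d) = (x - mlin mconst b c) + (y - mlin mconst b d)"
    by (simp add: mlin_add mconst_add)
  then have "x + y - mlin mconst b (c + d) \<in> J" using J_add[OF *(2,4)] by (simp only:)
  moreover have "Poly_Mapping.keys (c + d) \<subseteq> M" using keys_add[of c d] *(1,3) by blast
  ultimately show ?case by blast
qed

section \<open>Reduction to digit products for one variable and one prime power\<close>

context
  fixes i :: 'i and q :: nat
  assumes i: "i \<in> I" and q: "primepow q"
begin

abbreviation Y :: "nat \<Rightarrow> ('i gen_var, 'k) mpol" where
  "Y \<equiv> \<lambda>k. mvar (Iter i q k)"

lemma q_gt_1: "q > 1"
  using primepow_gt_Suc_0[OF q] by simp

lemma digit_prod_in_A: "digit_prod q Y k n \<in> carrier A"
  by (rule digit_prod_induct) (auto intro: A.closed Iter_in_A i q)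

text \<open>The factor \<open>Y k ^ r\<close> inserts \<open>r\<close> as a new lowest digit, which
  is admissible because \<open>r < q\<close>.\<close>

lemma jspan_digit_shift:
  assumes "r < q" "x \<in> jspan UNIV (digit_prod q Y (Suc k))"
  shows "Y k ^ r * x \<in> jspan UNIV (digit_prod q Y k)"
proof (rule jspan_mult_into[OF assms(2)])
  show "Y k ^ r \<in> carrier A" by (intro A.power_closed Iter_in_A i q)
  show "Y k ^ r * digit_prod q Y (Suc k) m \<in> jspan UNIV (digit_prod q Y k)" for m
    using digit_prod_shift[OF assms(1) q_gt_1, of Y k m] jspan_gen[of "r + q * m" UNIV "digit_prod q Y k"]
    by simp
qed

text \<open>This raises the lowest digit by one. If it reaches \<open>q\<close>, the relation
  replaces \<open>Y k ^ q\<close> by \<open>Y k + mconst (\<pi> q) * Y (Suc k)\<close>, and the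
  carry multiplies the digit product at the next level, where the induction hypothesis
  applies.\<close>

lemma Y_mult_digit_prod: "Y k * digit_prod q Y k n \<in> jspan UNIV (digit_prod q Y k)"
proof (induction n arbitrary: k rule: less_induct)
  case (less n)
  let ?r = "n mod q" and ?x = "digit_prod q Y (Suc k) (n div q)"
  have x: "?x \<in> jspan UNIV (digit_prod q Y (Suc k))" by (rule jspan_gen) simp
  have eq: "Y k * digit_prod q Y k n = Y k ^ Suc ?r * ?x"
    unfolding digit_prod_rec[OF q_gt_1, of Y k n] by (simp add: mult.assoc)
  show ?case
  proof (cases "Suc ?r < q")
    case True
    then show ?thesis unfolding eq by (rule jspan_digit_shift[OF _ x])
  next
    case False
    then have r: "Suc ?r = q" using q_gt_1 mod_less_divisor[of q n] by linarith
    then have "n \<noteq> 0" using q_gt_1 by (intro notI) simp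
    then have "n div q < n" using q_gt_1 by simp
    \<comment> \<open>The exponent 0 inserts the digit 0, which moves a combination at level
      \<open>Suc k\<close> into the span at level \<open>k\<close>.\<close>
    from less.IH[OF this, of "Suc k"]
    have "Y k ^ 0 * (Y (Suc k) * ?x) \<in> jspan UNIV (digit_prod q Y k)"
      by (rule jspan_digit_shift[rotated]) (use q_gt_1 in simp)
    then have 1: "mconst (\<pi> q) * (Y (Suc k) * ?x) \<in> jspan UNIV (digit_prod q Y k)"
      using jspan_scale generator_closed[OF q] by simp
    have 2: "Y k ^ 1 * ?x \<in> jspan UNIV (digit_prod q Y k)"
      by (rule jspan_digit_shift[OF q_gt_1 x])
    have 3: "?x * (Y k ^ q - Y k - mconst (\<pi> q) * Y (Suc k)) \<in> jspan UNIV (digit_prod q Y k)"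
      by (intro jspan_J J_mult digit_prod_in_A relator_step i q)
    have "Y k ^ Suc ?r * ?x =
        ?x * (Y k ^ q - Y k - mconst (\<pi> q) * Y (Suc k)) +
          (Y k ^ 1 * ?x + mconst (\<pi> q) * (Y (Suc k) * ?x))"
      unfolding r by (simp add: algebra_simps)
    then show ?thesis unfolding eq using jspan_add[OF 3 jspan_add[OF 2 1]] by simp
  qed
qed

text \<open>A variable of a higher level passes by the lower digits and acts on the digit product of
  its own level.\<close>

lemma Y_add_mult_digit_prod: "Y (k + l) * digit_prod q Y k n \<in> jspan UNIV (digit_prod q Y k)"
proof (induction l arbitrary: k n)
  case 0
  then show ?case using Y_mult_digit_prod by simp
next
  case (Suc l)
  have "Y k ^ (n mod q) * (Y (Suc k + l) * digit_prod q Y (Suc k) (n div q)) \<in>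
      jspan UNIV (digit_prod q Y k)"
    by (rule jspan_digit_shift[OF _ Suc.IH]) (use q_gt_1 in simp)
  then show ?case
    unfolding digit_prod_rec[OF q_gt_1, of Y k n] by (simp add: mult.left_commute)
qed

end

text \<open>The index \<open>m\<close> is a monomial in the variables of the target ring because it
  will be the leading monomial of the image.\<close>

definition digit_mon :: "nat \<Rightarrow> ('i \<Rightarrow>\<^sub>0 nat) \<Rightarrow> ('i gen_var, 'k) mpol" where
  "digit_mon q m =
     (\<Prod>i\<in>Poly_Mapping.keys m. digit_prod q (\<lambda>k. mvar (Iter i q k)) 0 (Poly_Mapping.lookup m i))"

lemma digit_mon_superset:
  assumes "finite S" "Poly_Mapping.keys m \<subseteq> S"
  shows "digit_mon q m =
    (\<Prod>i\<in>S. digit_prod q (\<lambda>k. mvar (Iter i q k)) 0 (Poly_Mapping.lookup m i))"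
  unfolding digit_mon_def using assms
  by (intro prod.mono_neutral_left) (auto simp: not_in_keys_iff_lookup_eq_zero)

lemma digit_mon_add_single:
  assumes "Poly_Mapping.lookup m i = 0"
  shows "digit_mon q (m + Poly_Mapping.single i n) =
    digit_mon q m * digit_prod q (\<lambda>k. mvar (Iter i q k)) 0 n"
proof -
  let ?K = "Poly_Mapping.keys m"
  have i: "i \<notin> ?K" using assms by (simp add: in_keys_iff)
  have keys: "Poly_Mapping.keys (m + Poly_Mapping.single i n) \<subseteq> insert i ?K"
    using keys_add[of m "Poly_Mapping.single i n"] by (auto split: if_splits)
  have "(\<Prod>j\<in>?K. digit_prod q (\<lambda>k. mvar (Iter j q k)) 0 (Poly_Mapping.lookup (m + Poly_Mapping.single i n) j))
      = digit_mon q m"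
    unfolding digit_mon_def
    by (rule prod.cong) (use i in \<open>auto simp: lookup_add lookup_single when_def\<close>)
  then show ?thesis
    using digit_mon_superset[OF _ keys, of q] i assms by (simp add: lookup_add mult.commute)
qed

abbreviation digit_span :: "nat \<Rightarrow> ('i gen_var, 'k) mpol set" where
  "digit_span q \<equiv> jspan {m. Poly_Mapping.keys m \<subseteq> I} (digit_mon q)"

lemma digit_mon_in_A:
  assumes "primepow q" "Poly_Mapping.keys m \<subseteq> I"
  shows "digit_mon q m \<in> carrier A"
  unfolding digit_mon_def by (intro A.prod_closed digit_prod_in_A assms(1) subsetD[OF assms(2)])

text \<open>Only the factor belonging to \<open>i\<close> is rewritten; \<open>m'\<close> is
  \<open>m\<close> with that variable removed, and its digit product is carried along.\<close>

lemma Iter_mult_digit_mon: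
  assumes i: "i \<in> I" and q: "primepow q" and m: "Poly_Mapping.keys m \<subseteq> I"
  shows "mvar (Iter i q k) * digit_mon q m \<in> digit_span q"
proof -
  let ?n = "Poly_Mapping.lookup m i" and ?d = "\<lambda>n. digit_prod q (\<lambda>k. mvar (Iter i q k)) 0 n"
  define m' where "m' = m - Poly_Mapping.single i ?n"
  have m'i: "Poly_Mapping.lookup m' i = 0" by (simp add: m'_def lookup_minus)
  have m_eq: "m = m' + Poly_Mapping.single i ?n"
    by (rule poly_mapping_eqI) (auto simp: m'_def lookup_add lookup_minus lookup_single when_def)
  have keys: "Poly_Mapping.keys m' \<subseteq> I"
    using m by (auto simp: m'_def in_keys_iff lookup_minus)
  have "mvar (Iter i q k) * ?d ?n \<in> jspan UNIV ?d"
    using Y_add_mult_digit_prod[OF i q, of 0 k ?n] by simp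
  then have "digit_mon q m' * (mvar (Iter i q k) * ?d ?n) \<in> digit_span q"
  proof (rule jspan_mult_into)
    show "digit_mon q m' \<in> carrier A" by (rule digit_mon_in_A[OF q keys])
    fix n
    have "Poly_Mapping.keys (m' + Poly_Mapping.single i n) \<subseteq> I"
      using keys_add[of m' "Poly_Mapping.single i n"] keys i by (auto split: if_splits)
    then show "digit_mon q m' * ?d n \<in> digit_span q"
      unfolding digit_mon_add_single[OF m'i, symmetric] by (intro jspan_gen) simp
  qed
  moreover have "digit_mon q m = digit_mon q m' * ?d ?n"
    using digit_mon_add_single[OF m'i, of q ?n] m_eq by simp
  ultimately show ?thesis by (simp add: mult.left_commute)
qed

text \<open>Expresses membership in the digit span after inverting the \<open>\<pi> r\<close> with
  \<open>r \<noteq> q\<close>, without forming a localization.\<close>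

definition away_span :: "nat \<Rightarrow> ('i gen_var, 'k) mpol set" where
  "away_span q = {f \<in> carrier A. \<exists>s\<in>away q. mconst s * f \<in> digit_span q}"

lemma away_spanI: "f \<in> carrier A \<Longrightarrow> s \<in> away q \<Longrightarrow> mconst s * f \<in> digit_span q \<Longrightarrow> f \<in> away_span q"
  unfolding away_span_def by blast

lemma away_spanE:
  assumes "f \<in> away_span q"
  obtains s where "f \<in> carrier A" "s \<in> away q" "mconst s * f \<in> digit_span q"
  using assms unfolding away_span_def by blast

lemma away_span_add:
  assumes "f \<in> away_span q" "g \<in> away_span q"
  shows "f + g \<in> away_span q"
proof -
  obtain s where s: "f \<in> carrier A" "s \<in> away q" "mconst s * f \<in> digit_span q"
    using assms(1) by (rule away_spanE)
  obtain t where t: "g \<in> carrier A" "t \<in> away q" "mconst t * g \<in> digit_span q"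
    using assms(2) by (rule away_spanE)
  have "mconst t * (mconst s * f) + mconst s * (mconst t * g) \<in> digit_span q"
    by (intro jspan_add jspan_scale s t away_closed[OF s(2)] away_closed[OF t(2)])
  then have "mconst (s * t) * (f + g) \<in> digit_span q"
    by (simp add: mconst_mult algebra_simps)
  then show ?thesis
    by (rule away_spanI[OF A.add_closed[OF s(1) t(1)] away_mult[OF s(2) t(2)]])
qed

lemma away_span_scale:
  assumes "f \<in> away_span q" "d \<in> D"
  shows "mconst d * f \<in> away_span q"
proof -
  obtain s where s: "f \<in> carrier A" "s \<in> away q" "mconst s * f \<in> digit_span q"
    using assms(1) by (rule away_spanE)
  have "mconst s * (mconst d * f) \<in> digit_span q"
    using jspan_scale[OF s(3) assms(2)] by (simp add: mult.left_commute)
  then show ?thesis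
    by (rule away_spanI[OF A.mult_closed[OF mconst_in_A[OF assms(2)] s(1)] s(2)])
qed

lemma away_span_diff:
  assumes "f \<in> away_span q" "g \<in> away_span q"
  shows "f - g \<in> away_span q"
  using away_span_add[OF assms(1) away_span_scale[OF assms(2) uminus_closed[OF one_closed]]]
  by (simp add: mconst_uminus)

lemma away_span_cong:
  assumes "g \<in> away_span q" "f - g \<in> J"
  shows "f \<in> away_span q"
proof -
  have "f - g \<in> away_span q"
    by (rule away_spanI[OF J_subset[OF assms(2)] away_one]) (simp add: jspan_J assms(2))
  from away_span_add[OF this assms(1)] show ?thesis by simp
qed

lemma away_span_unscale:
  assumes "mconst (\<pi> r) * f \<in> away_span q" "f \<in> carrier A" "primepow r" "r \<noteq> q"
  shows "f \<in> away_span q"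
proof -
  obtain s where s: "s \<in> away q" "mconst s * (mconst (\<pi> r) * f) \<in> digit_span q"
    using assms(1) by (rule away_spanE)
  then have "mconst (\<pi> r * s) * f \<in> digit_span q" by (simp add: mconst_mult mult_ac)
  then show ?thesis by (rule away_spanI[OF assms(2) away_step[OF s(1) assms(3,4)]])
qed

lemma away_span_mult_own:
  assumes "f \<in> away_span q" "i \<in> I" "primepow q"
  shows "mvar (Iter i q k) * f \<in> away_span q"
proof -
  obtain s where s: "f \<in> carrier A" "s \<in> away q" "mconst s * f \<in> digit_span q"
    using assms(1) by (rule away_spanE)
  have "mvar (Iter i q k) * (mconst s * f) \<in> digit_span q"
    by (rule jspan_mult_into[OF s(3)])
      (use assms Iter_in_A Iter_mult_digit_mon in auto)
  then have "mconst s * (mvar (Iter i q k) * f) \<in> digit_span q" by (simp add: mult.left_commute)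
  then show ?thesis
    by (rule away_spanI[OF A.mult_closed[OF Iter_in_A[OF assms(2,3)] s(1)] s(2)])
qed

lemma away_span_in_A: "f \<in> away_span q \<Longrightarrow> f \<in> carrier A"
  by (rule away_spanE)

lemma away_span_mult_Base:
  assumes "f \<in> away_span q" "i \<in> I" "primepow q"
  shows "mvar (Base i) * f \<in> away_span q"
proof (rule away_span_cong[OF away_span_mult_own[OF assms, of 0]])
  have "- f * (mvar (Iter i q 0) - mvar (Base i)) \<in> J"
    by (rule J_mult[OF A.uminus_closed[OF away_span_in_A[OF assms(1)]] relator_base[OF assms(2,3)]])
  then show "mvar (Base i) * f - mvar (Iter i q 0) * f \<in> J" by (simp add: algebra_simps)
qed

text \<open>
  For \<open>r \<noteq> q\<close> the element \<open>\<pi>\<^sub>r\<close> may be inverted, so the relations express each \<open>X\<^bsub>i,r,k+1\<^esub>\<close>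
  through \<open>X\<^bsub>i,r,k\<^esub>\<close>.
\<close>

lemma away_span_mult_other:
  assumes "f \<in> away_span q" "i \<in> I" "primepow q" "primepow r" "r \<noteq> q"
  shows "mvar (Iter i r k) * f \<in> away_span q"
  using assms(1)
proof (induction k arbitrary: f)
  case 0
  show ?case
  proof (rule away_span_cong[OF away_span_mult_Base[OF 0 assms(2,3)]])
    have "f * (mvar (Iter i r 0) - mvar (Base i)) \<in> J"
      by (rule J_mult[OF away_span_in_A[OF 0] relator_base[OF assms(2,4)]])
    then show "mvar (Iter i r 0) * f - mvar (Base i) * f \<in> J" by (simp add: algebra_simps)
  qed
next
  case (Suc k)
  let ?Y = "\<lambda>k. mvar (Iter i r k) :: ('i gen_var, 'k) mpol"
  note mult_Y = Suc.IH and f = Suc.prems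
  \<comment> \<open>The hypothesis for \<open>k\<close> holds for every element of the span, so it
    can be applied repeatedly.\<close>
  have pow: "?Y k ^ e * f \<in> away_span q" for e
    by (induction e) (use mult_Y f in \<open>simp_all add: mult.assoc\<close>)
  have "mconst (\<pi> r) * (?Y (Suc k) * f) \<in> away_span q"
  proof (rule away_span_cong[OF away_span_diff[OF pow[of r] pow[of 1]]])
    have "- f * (?Y k ^ r - ?Y k - mconst (\<pi> r) * ?Y (Suc k)) \<in> J"
      by (rule J_mult[OF A.uminus_closed[OF away_span_in_A[OF Suc.prems]] relator_step[OF assms(2,4)]])
    then show "mconst (\<pi> r) * (?Y (Suc k) * f) - (?Y k ^ r * f - ?Y k ^ 1 * f) \<in> J"
      by (simp add: algebra_simps)
  qed
  then show ?case
    by (rule away_span_unscale)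
      (intro A.mult_closed Iter_in_A away_span_in_A[OF f] assms)+
qed

text \<open>Constants are multiples of the empty digit product, and all generators preserve the
  span; hence digit products for a single \<open>q\<close> suffice up to a multiplier.\<close>

lemma away_span_eq_A:
  assumes f: "f \<in> carrier A" and q: "primepow q"
  shows "f \<in> away_span q"
  using f zero_closed
proof (induction f rule: mpol_ring_induct)
  case (const d)
  have "mconst 1 * mconst d = mconst d * digit_mon q 0" by (simp add: digit_mon_def)
  also have "\<dots> \<in> digit_span q" by (intro jspan_base) (use const in auto)
  finally show ?case by (rule away_spanI[OF mconst_in_A[OF const] away_one])
next
  case (var v f)
  then consider i where "v = Base i" "i \<in> I" | i r k where "v = Iter i r k" "i \<in> I" "primepow r"
    by (auto simp: gen_vars_def)
  then show ?case
  proof cases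
    case 1
    then show ?thesis using away_span_mult_Base var q by blast
  next
    case (2 i r k)
    then show ?thesis
      using away_span_mult_own away_span_mult_other var q by (cases "r = q") blast+
  qed
qed (rule away_span_add)

end

section \<open>Kernel and image\<close>

context presentation
begin

lemma msubst_digit_mon:
  "\<phi> (digit_mon q m) =
    (\<Prod>i\<in>Poly_Mapping.keys m.
       poly_at_var (digit_prod q (\<lambda>k. poly_iterate k (F_poly \<pi> q)) 0 (Poly_Mapping.lookup m i)) i)"
proof -
  have "\<phi> (digit_prod q (\<lambda>k. mvar (Iter i q k)) 0 n) =
      poly_at_var (digit_prod q (\<lambda>k. poly_iterate k (F_poly \<pi> q)) 0 n) i" for i n
  proof -
    have "\<phi> (digit_prod q (\<lambda>k. mvar (Iter i q k)) 0 n) =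
        digit_prod q (\<lambda>k. poly_at_var (poly_iterate k (F_poly \<pi> q)) i) 0 n"
      by (subst digit_prod_hom[of \<phi>]) (simp_all add: msubst_mult gen_image_def)
    also have "\<dots> = poly_at_var (digit_prod q (\<lambda>k. poly_iterate k (F_poly \<pi> q)) 0 n) i"
      by (rule digit_prod_hom[symmetric, of "\<lambda>p. poly_at_var p i"]) (simp_all add: poly_at_var_mult)
    finally show ?thesis .
  qed
  then show ?thesis by (simp add: digit_mon_def msubst_prod)
qed

text \<open>At level 0 the digit product for exponent \<open>n\<close> has degree exactly
  \<open>n\<close>, so the leading monomials of the factors multiply to \<open>m\<close>.\<close>

lemma has_lead_msubst_digit_mon:
  assumes "primepow q"
  shows "\<exists>c. c \<noteq> 0 \<and> has_lead (\<phi> (digit_mon q m)) m c"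
proof -
  have q: "q > 1" "\<pi> q \<noteq> 0" using primepow_gt_Suc_0[OF assms] generator_nonzero[OF assms] by auto
  let ?G = "\<lambda>i. digit_prod q (\<lambda>k. poly_iterate k (F_poly \<pi> q)) 0 (Poly_Mapping.lookup m i)"
  have deg: "Polynomial.degree (?G i) = Poly_Mapping.lookup m i" for i
    using digit_prod_poly_iterate(1)[of \<pi> q, OF q(2,1), of 0] by simp
  have lead: "lead_coeff (?G i) \<noteq> 0" for i
    using digit_prod_poly_iterate(2)[of \<pi> q, OF q(2,1), of 0 "Poly_Mapping.lookup m i"] q(2) by simp
  have "has_lead (\<phi> (digit_mon q m))
      (\<Sum>i\<in>Poly_Mapping.keys m. Poly_Mapping.single i (Polynomial.degree (?G i)))
      (\<Prod>i\<in>Poly_Mapping.keys m. lead_coeff (?G i))"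
    unfolding msubst_digit_mon by (intro has_lead_prod has_lead_poly_at_var)
  moreover have "(\<Sum>i\<in>Poly_Mapping.keys m. Poly_Mapping.single i (Polynomial.degree (?G i))) = m"
    unfolding deg by (rule poly_mapping_sum_single[symmetric])
  moreover have "(\<Prod>i\<in>Poly_Mapping.keys m. lead_coeff (?G i)) \<noteq> 0"
    unfolding prod_zero_iff[OF finite_keys] using lead by blast
  ultimately show ?thesis by metis
qed

lemma msubst_mlin: "msubst s (mlin mconst b c) = mlin mconst (\<lambda>m. msubst s (b m)) c"
  by (simp add: mlin_def msubst_sum msubst_mult)

lemma msubst_relator: "x \<in> relators \<pi> I \<Longrightarrow> \<phi> x = 0"
proof -
  assume "x \<in> relators \<pi> I"
  then consider i q where "primepow q" "x = mvar (Iter i q 0) - mvar (Base i)"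
    | i q k where "primepow q"
        "x = mvar (Iter i q k) ^ q - mvar (Iter i q k) - mconst (\<pi> q) * mvar (Iter i q (Suc k))"
    unfolding relators_def by blast
  then show "\<phi> x = 0"
  proof cases
    case (1 i q)
    then show ?thesis by (simp add: msubst_diff gen_image_def)
  next
    case (2 i q k)
    let ?P = "poly_iterate k (F_poly \<pi> q)"
    have "mconst (\<pi> q) * poly_at_var (poly_iterate (Suc k) (F_poly \<pi> q)) i =
        poly_at_var (Polynomial.smult (\<pi> q) (Polynomial.smult (1 / \<pi> q) (?P ^ q - ?P))) i"
      unfolding poly_iterate_Suc by (simp only: poly_at_var_smult)
    also have "\<dots> = poly_at_var ?P i ^ q - poly_at_var ?P i"
      using generator_nonzero[OF 2(1)] by (simp add: poly_at_var_diff poly_at_var_power)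
    finally show ?thesis
      unfolding 2(2) by (simp add: msubst_diff msubst_mult msubst_power gen_image_def)
  qed
qed

lemma msubst_J:
  assumes "x \<in> J"
  shows "\<phi> x = 0"
proof -
  let ?K = "{f \<in> carrier A. \<phi> f = 0}"
  have "ideal ?K A"
    unfolding ideal_A_iff
  proof (intro conjI ballI)
    show "0 \<in> ?K" using A.zero_closed by simp
  qed (auto simp: msubst_add msubst_mult intro: A.closed)
  moreover have "relators \<pi> I \<subseteq> ?K" using relators_subset msubst_relator by blast
  ultimately have "J \<subseteq> ?K" by (rule ring.genideal_minimal[OF cring.axioms(1)[OF cring_A]])
  with assms show ?thesis by blast
qed

lemma kernel_subset_J:
  assumes f: "f \<in> carrier A" "\<phi> f = 0"
  shows "f \<in> J"
proof -
  have "\<exists>s\<in>away q. mconst s * f \<in> J" if q: "primepow q" for q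
  proof -
    obtain s where s: "s \<in> away q" "mconst s * f \<in> digit_span q"
      using away_span_eq_A[OF f(1) q] by (rule away_spanE)
    obtain c where c: "mconst s * f - mlin mconst (digit_mon q) c \<in> J"
      using jspan_representation[OF s(2)] by blast
    \<comment> \<open>Applying \<open>\<phi>\<close> kills both \<open>f\<close> and the element of
      \<open>J\<close>; the distinct leading monomials then force \<open>c = 0\<close>.\<close>
    have "mlin mconst (\<lambda>m. \<phi> (digit_mon q m)) c = 0"
      using msubst_J[OF c] f(2) by (simp add: msubst_diff msubst_mult msubst_mlin)
    then have "c = 0"
      by (rule mlin_eq_0_imp_eq_0[rotated]) (rule has_lead_msubst_digit_mon[OF q])
    with c s(1) show ?thesis by auto
  qed
  \<comment> \<open>The multipliers of \<open>f\<close> into \<open>J\<close> are stable under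
    addition and under \<open>D\<close>, and they meet every \<open>away q\<close>.\<close>
  then have "1 \<in> {d. mconst d * f \<in> J}"
    by (intro one_mem_if_away)
      (auto simp: mconst_add mconst_mult distrib_right mult.assoc intro: J_add J_mult mconst_in_A)
  then show ?thesis by simp
qed

section \<open>The target ring and elements of the image\<close>

lemma carrier_int_valued_ring:
  "f \<in> carrier (int_valued_ring D I) \<longleftrightarrow> mvars f \<subseteq> I \<and> (\<forall>x\<in>I \<rightarrow> D. meval x f \<in> D)"
  by (simp add: int_valued_ring_def)

lemma type_subring_int_valued: "type_subring (carrier (int_valued_ring D I))"
proof -
  interpret M: type_subring "{f :: ('i, 'k) mpol. mvars f \<subseteq> I}" by (rule type_subring_mvars)
  show ?thesis
  proof
    show "1 \<in> carrier (int_valued_ring D I)"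
      using M.one_closed one_closed by (simp add: carrier_int_valued_ring)
    fix f assume f: "f \<in> carrier (int_valued_ring D I)"
    then show "- f \<in> carrier (int_valued_ring D I)"
      using uminus_closed by (simp add: carrier_int_valued_ring meval_uminus)
    fix g assume g: "g \<in> carrier (int_valued_ring D I)"
    show "f + g \<in> carrier (int_valued_ring D I)" "f * g \<in> carrier (int_valued_ring D I)"
      using f g M.add_closed[of f g] M.mult_closed[of f g] add_closed mult_closed
      by (simp_all add: carrier_int_valued_ring meval_add meval_mult)
  qed
qed

lemma poly_at_var_int_valued:
  "i \<in> I \<Longrightarrow> p \<in> int_valued D \<Longrightarrow> poly_at_var p i \<in> carrier (int_valued_ring D I)"
  using mvars_poly_at_var[of p i]
  unfolding carrier_int_valued_ring meval_poly_at_var int_valued_def by blast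

lemma gen_image_int_valued:
  assumes "v \<in> gen_vars I"
  shows "gen_image v \<in> carrier (int_valued_ring D I)"
proof -
  have "poly_iterate k (F_poly \<pi> q) \<in> int_valued D" if "primepow q" for k q
    using poly_iterate_int_valued[OF F_poly_int_valued[OF that]] by (simp add: int_valued_def)
  note P = this
  have X: "[:0, 1:] \<in> int_valued D" by (simp add: int_valued_def)
  from assms consider i where "v = Base i" "i \<in> I"
    | i q k where "v = Iter i q k" "i \<in> I" "primepow q"
    unfolding gen_vars_def by blast
  then show ?thesis
  proof cases
    case 1
    then show ?thesis using poly_at_var_int_valued[OF 1(2) X] by (simp add: gen_image_def)
  next
    case 2
    then show ?thesis using poly_at_var_int_valued[OF 2(2) P[OF 2(3)]] by (simp add: gen_image_def)
  qed
qed

lemma msubst_int_valued: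
  assumes "f \<in> carrier A"
  shows "\<phi> f \<in> carrier (int_valued_ring D I)"
proof -
  interpret B: type_subring "carrier (int_valued_ring D I)" by (rule type_subring_int_valued)
  show ?thesis
    using assms zero_closed
  proof (induction f rule: mpol_ring_induct)
    case (const d)
    then show ?case by (simp add: carrier_int_valued_ring)
  next
    case (var v f)
    then show ?case using gen_image_int_valued B.mult_closed by (simp add: msubst_mult)
  next
    case (add f g)
    then show ?case using B.add_closed by (simp add: msubst_add)
  qed
qed

abbreviation gen_ring :: "('i, 'k) mpol set" where
  "gen_ring \<equiv> \<phi> ` carrier A"

lemma gen_ring_add: "f \<in> gen_ring \<Longrightarrow> g \<in> gen_ring \<Longrightarrow> f + g \<in> gen_ring"
  by (auto simp flip: msubst_add intro!: imageI A.add_closed)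

lemma gen_ring_mult: "f \<in> gen_ring \<Longrightarrow> g \<in> gen_ring \<Longrightarrow> f * g \<in> gen_ring"
  by (auto simp flip: msubst_mult intro!: imageI A.mult_closed)

lemma gen_ring_mconst: "d \<in> D \<Longrightarrow> mconst d \<in> gen_ring"
  using imageI[OF mconst_in_A, of d \<phi>] by simp

lemma gen_ring_poly_iterate:
  assumes "i \<in> I" "primepow q"
  shows "poly_at_var (poly_iterate k (F_poly \<pi> q)) i \<in> gen_ring"
  using imageI[OF Iter_in_A[OF assms, of k], of \<phi>] by (simp add: gen_image_def)

text \<open>The partial fraction step: the leading coefficients for the individual \<open>q\<close> are combined.\<close>

lemma regular_basis_element:
  "\<exists>g. Polynomial.degree g \<le> n \<and> Polynomial.coeff g n = 1 / char_denom n \<and> (\<forall>i\<in>I. poly_at_var g i \<in> gen_ring)"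
proof -
  \<comment> \<open>The numerators over \<open>char_denom n\<close> that occur. Prescribing the
    coefficient at \<open>n\<close> together with degree at most \<open>n\<close>, instead of the
    leading coefficient, makes this set closed under sums even when top terms cancel.\<close>
  let ?L = "{d. \<exists>g. Polynomial.degree g \<le> n \<and> Polynomial.coeff g n = d / char_denom n \<and>
      (\<forall>i\<in>I. poly_at_var g i \<in> gen_ring)}"
  have "1 \<in> ?L"
  proof (rule one_mem_if_away)
    fix x y assume "x \<in> ?L" "y \<in> ?L"
    then obtain g h where g: "Polynomial.degree g \<le> n" "Polynomial.coeff g n = x / char_denom n"
        "\<forall>i\<in>I. poly_at_var g i \<in> gen_ring"
      and h: "Polynomial.degree h \<le> n" "Polynomial.coeff h n = y / char_denom n"
        "\<forall>i\<in>I. poly_at_var h i \<in> gen_ring"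
      by blast
    have "Polynomial.degree (g + h) \<le> n" by (rule degree_add_le[OF g(1) h(1)])
    moreover have "Polynomial.coeff (g + h) n = (x + y) / char_denom n"
      using g(2) h(2) by (simp add: add_divide_distrib)
    moreover have "\<forall>i\<in>I. poly_at_var (g + h) i \<in> gen_ring"
      using g(3) h(3) gen_ring_add unfolding poly_at_var_add by blast
    ultimately show "x + y \<in> ?L" by blast
  next
    fix d x assume d: "d \<in> D" and "x \<in> ?L"
    then obtain g where g: "Polynomial.degree g \<le> n" "Polynomial.coeff g n = x / char_denom n"
        "\<forall>i\<in>I. poly_at_var g i \<in> gen_ring" by blast
    have "Polynomial.degree (Polynomial.smult d g) \<le> n" using g(1) degree_smult_le le_trans by blast
    moreover have "Polynomial.coeff (Polynomial.smult d g) n = d * x / char_denom n"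
      using g(2) by simp
    moreover have "\<forall>i\<in>I. poly_at_var (Polynomial.smult d g) i \<in> gen_ring"
      using g(3) gen_ring_mult gen_ring_mconst[OF d] unfolding poly_at_var_smult by blast
    ultimately show "d * x \<in> ?L" by blast
  next
    fix q :: nat assume q: "primepow q"
    obtain s where s: "s \<in> away q" "char_denom n = \<pi> q ^ legendre_exp q n * s"
      using char_denom_away[OF q] by blast
    have q': "q > 1" "\<pi> q \<noteq> 0" using primepow_gt_Suc_0[OF q] generator_nonzero[OF q] by auto
    let ?g = "digit_prod q (\<lambda>k. poly_iterate k (F_poly \<pi> q)) 0 n"
    have deg: "Polynomial.degree ?g = n"
      using digit_prod_poly_iterate(1)[of \<pi> q, OF q'(2,1), of 0 n] by simp
    have "lead_coeff ?g = 1 / \<pi> q ^ legendre_exp q n"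
      using digit_prod_poly_iterate(2)[of \<pi> q, OF q'(2,1), of 0 n] by simp
    \<comment> \<open>Extending the fraction by the part \<open>s\<close> of
      \<open>char_denom n\<close> away from \<open>q\<close> shows that \<open>s\<close> is one of
      the numerators.\<close>
    then have "Polynomial.coeff ?g n = s / char_denom n"
      unfolding deg using s(2) char_denom_nonzero[of n] by (simp add: field_simps)
    moreover have "poly_at_var ?g i \<in> gen_ring" if "i \<in> I" for i
    proof (rule digit_prod_induct[where P = "\<lambda>p. poly_at_var p i \<in> gen_ring"])
      show "poly_at_var 1 i \<in> gen_ring" using gen_ring_mconst[OF one_closed] by simp
      show "poly_at_var (poly_iterate k (F_poly \<pi> q)) i \<in> gen_ring" for k
        by (rule gen_ring_poly_iterate[OF that q])
      show "poly_at_var (a * b) i \<in> gen_ring"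
        if "poly_at_var a i \<in> gen_ring" "poly_at_var b i \<in> gen_ring" for a b
        unfolding poly_at_var_mult by (rule gen_ring_mult[OF that])
    qed
    moreover have "Polynomial.degree ?g \<le> n" using deg by simp
    ultimately have "s \<in> ?L" by (intro CollectI exI[of _ ?g]) simp
    with s(1) show "\<exists>s\<in>away q. s \<in> ?L" by blast
  qed
  then show ?thesis by blast
qed

end

text \<open>Views \<open>f\<close> as a polynomial in \<open>v\<close> over the other variables, so
  that its top term in \<open>v\<close> can be removed.\<close>

lemma mpol_split_var:
  fixes f :: "('v, 'k::field) mpol"
  assumes "mvars f \<subseteq> insert v V"
  shows "\<exists>N h. (\<forall>n. mvars (h n) \<subseteq> V) \<and> f = (\<Sum>n<N::nat. h n * mvar v ^ n)"
proof -
  have "f \<in> carrier (mpol_ring UNIV (insert v V))" using assms by (simp add: mpol_ring_def)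
  then show ?thesis
    using UNIV_I
  proof (induction f rule: mpol_ring_induct)
    case (const c)
    show ?case by (intro exI[of _ 1] exI[of _ "\<lambda>_. mconst c"]) simp
  next
    case (var w f)
    then obtain N h where h: "\<And>n. mvars (h n) \<subseteq> V" "f = (\<Sum>n<N. h n * mvar v ^ n)" by blast
    show ?case
    proof (cases "w = v")
      case True
      define h' where "h' n = (case n of 0 \<Rightarrow> 0 | Suc m \<Rightarrow> h m)" for n
      have "mvar w * f = (\<Sum>n<Suc N. h' n * mvar v ^ n)"
        unfolding h(2) True
        by (simp add: sum.lessThan_Suc_shift h'_def sum_distrib_left mult_ac del: sum.lessThan_Suc)
      moreover have "mvars (h' n) \<subseteq> V" for n using h(1) by (simp add: h'_def split: nat.split)
      ultimately show ?thesis by (intro exI[of _ "Suc N"] exI[of _ h']) simp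
    next
      case False
      then have "mvars (mvar w * h n) \<subseteq> V" for n
        using mvars_mult[of "mvar w" "h n"] h(1)[of n] var(1) by auto
      moreover have "mvar w * f = (\<Sum>n<N. (mvar w * h n) * mvar v ^ n)"
        unfolding h(2) by (simp add: sum_distrib_left mult.assoc)
      ultimately show ?thesis by (intro exI[of _ N] exI[of _ "\<lambda>n. mvar w * h n"]) simp
    qed
  next
    case (add f g)
    obtain N h where h: "\<And>n. mvars (h n) \<subseteq> V" "f = (\<Sum>n<N. h n * mvar v ^ n)"
      using add(1) by blast
    obtain M k where k: "\<And>n. mvars (k n) \<subseteq> V" "g = (\<Sum>n<M. k n * mvar v ^ n)"
      using add(2) by blast
    let ?L = "max N M"
    \<comment> \<open>The values of \<open>h\<close> and \<open>k\<close> beyond their ranges are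
      arbitrary and must be cut off before adding.\<close>
    define l where "l n = (if n < N then h n else 0) + (if n < M then k n else 0)" for n
    have "f = (\<Sum>n<?L. (if n < N then h n else 0) * mvar v ^ n)"
      unfolding h(2) by (rule sum.mono_neutral_cong_left) auto
    moreover have "g = (\<Sum>n<?L. (if n < M then k n else 0) * mvar v ^ n)"
      unfolding k(2) by (rule sum.mono_neutral_cong_left) auto
    ultimately have "f + g = (\<Sum>n<?L. l n * mvar v ^ n)"
      unfolding l_def distrib_right sum.distrib by simp
    moreover have "mvars (l n) \<subseteq> V" for n
      using mvars_add[of "if n < N then h n else 0" "if n < M then k n else 0"] h(1)[of n] k(1)[of n]
      unfolding l_def by (auto split: if_splits)
    ultimately show ?case by (intro exI[of _ ?L] exI[of _ l]) simp
  qed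
qed

section \<open>Surjectivity by removing top terms\<close>

context presentation
begin

text \<open>Outer induction on the variables, inner induction on the number of powers of
  \<open>v\<close>. After scaling by \<open>char_denom N\<close>, the top coefficient is
  integer-valued in fewer variables, hence in the image; multiplying it by a basis element of degree
  \<open>N\<close> in \<open>v\<close> cancels the top term.\<close>

lemma int_valued_in_gen_ring:
  assumes V: "finite V" "V \<subseteq> I"
    and f: "mvars f \<subseteq> V" "\<And>x. x \<in> I \<rightarrow> D \<Longrightarrow> meval x f \<in> D"
  shows "f \<in> gen_ring"
  using V f
proof (induction V arbitrary: f rule: finite_induct)
  case empty
  then have keys: "Poly_Mapping.keys f \<subseteq> {0}" by (auto simp: mvars_def)
  have "f = mconst (Poly_Mapping.lookup f 0)"
    by (rule poly_mapping_eqI)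
      (use keys in \<open>auto simp: mconst_def lookup_single when_def in_keys_iff\<close>)
  moreover from this have "Poly_Mapping.lookup f 0 = meval (\<lambda>_. 0) f" by (metis meval_mconst)
  \<comment> \<open>A constant polynomial is recovered from its value at the origin, a point over
    \<open>D\<close>.\<close>
  moreover have "meval (\<lambda>_. 0) f \<in> D" by (rule empty.prems(3)) (use zero_closed in auto)
  ultimately show ?case using gen_ring_mconst by metis
next
  case (insert v V)
  have v: "v \<in> I" and VI: "V \<subseteq> I" using insert.prems(1) by auto
  have IH: "g \<in> gen_ring" if "mvars g \<subseteq> V" "\<And>x. x \<in> I \<rightarrow> D \<Longrightarrow> meval x g \<in> D" for g
    by (rule insert.IH[OF VI that])
  have "(\<Sum>n<N. h n * mvar v ^ n) \<in> gen_ring"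
    if "\<And>n. mvars (h n) \<subseteq> V"
      "\<And>x. x \<in> I \<rightarrow> D \<Longrightarrow> meval x (\<Sum>n<N. h n * mvar v ^ n) \<in> D" for N h
    using that
  proof (induction N arbitrary: h)
    case 0
    then show ?case using gen_ring_mconst[OF zero_closed] by simp
  next
    case (Suc N)
    let ?f = "\<Sum>n<Suc N. h n * mvar v ^ n"
    have top: "meval x (mconst (char_denom N) * h N) \<in> D" if x: "x \<in> I \<rightarrow> D" for x
    proof -
      \<comment> \<open>Freezing the other variables at \<open>x\<close> gives a polynomial in
        \<open>v\<close> alone. It is integer-valued because the \<open>h n\<close> do not involve
        \<open>v\<close>, so that variable can take any value \<open>d\<close> in
        \<open>D\<close>.\<close>
      define p where "p = (\<Sum>n<Suc N. Polynomial.monom (meval x (h n)) n)"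
      have "poly p d \<in> D" if d: "d \<in> D" for d
      proof -
        have "meval (x(v := d)) (h n) = meval x (h n)" for n
          by (rule meval_cong) (use Suc.prems(1)[of n] insert.hyps(2) in auto)
        then have eq: "meval (x(v := d)) ?f = poly p d"
          by (simp add: p_def meval_add meval_sum meval_mult meval_power poly_sum poly_monom)
        have "x(v := d) \<in> I \<rightarrow> D" using x d by auto
        then have "meval (x(v := d)) ?f \<in> D" by (rule Suc.prems(2))
        then show ?thesis unfolding eq .
      qed
      then have "p \<in> int_valued D" by (simp add: int_valued_def)
      moreover have "Polynomial.degree p \<le> N"
        unfolding p_def by (rule degree_sum_le) (auto intro: le_trans[OF degree_monom_le])
      moreover have "Polynomial.coeff p N = meval x (h N)"
        by (simp add: p_def coeff_sum)
      ultimately show ?thesis using char_denom_mult_coeff[of p N] by (simp add: meval_mult)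
    qed
    have "mvars (mconst (char_denom N) * h N) \<subseteq> V"
      using mvars_mult[of "mconst (char_denom N)" "h N"] Suc.prems(1)[of N] by simp
    from IH[OF this top] have top_mem: "mconst (char_denom N) * h N \<in> gen_ring" .
    obtain g where g: "Polynomial.degree g \<le> N" "Polynomial.coeff g N = 1 / char_denom N"
        "poly_at_var g v \<in> gen_ring"
      using regular_basis_element v by blast
    define t where "t = mconst (char_denom N) * h N * poly_at_var g v"
    have t: "t \<in> gen_ring" unfolding t_def by (rule gen_ring_mult[OF top_mem g(3)])
    \<comment> \<open>The coefficients of \<open>?f - t\<close> as a polynomial in \<open>v\<close>;
      the one at \<open>N\<close> vanishes since
      \<open>char_denom N * Polynomial.coeff g N = 1\<close>.\<close>
    define h' where "h' n = h n - mconst (char_denom N * Polynomial.coeff g n) * h N" for n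
    have "t = (\<Sum>n<Suc N. mconst (char_denom N * Polynomial.coeff g n) * h N * mvar v ^ n)"
      unfolding t_def using poly_at_var_altdef[of g "Suc N" v] g(1)
      by (simp add: sum_distrib_left mconst_mult distrib_left mult_ac)
    then have "?f - t = (\<Sum>n<Suc N. h' n * mvar v ^ n)"
      unfolding h'_def left_diff_distrib sum_subtractf by simp
    also have "h' N = 0" using g(2) char_denom_nonzero[of N] by (simp add: h'_def)
    then have "(\<Sum>n<Suc N. h' n * mvar v ^ n) = (\<Sum>n<N. h' n * mvar v ^ n)" by simp
    finally have eq: "?f - t = (\<Sum>n<N. h' n * mvar v ^ n)" .
    have "(\<Sum>n<N. h' n * mvar v ^ n) \<in> gen_ring"
    proof (rule Suc.IH)
      show "mvars (h' n) \<subseteq> V" for n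
        using mvars_diff[of "h n" "mconst (char_denom N * Polynomial.coeff g n) * h N"]
          mvars_mult[of "mconst (char_denom N * Polynomial.coeff g n)" "h N"]
          Suc.prems(1)[of n] Suc.prems(1)[of N]
        unfolding h'_def by auto
      fix x assume x: "x \<in> I \<rightarrow> D"
      have "meval x t \<in> D"
        using t msubst_int_valued x by (auto simp: carrier_int_valued_ring)
      then show "meval x (\<Sum>n<N. h' n * mvar v ^ n) \<in> D"
        unfolding eq[symmetric] meval_diff by (intro diff_closed Suc.prems(2) x)
    qed
    then have "(?f - t) + t \<in> gen_ring" unfolding eq using t by (rule gen_ring_add)
    then show ?case by simp
  qed
  moreover obtain N h where "\<And>n. mvars (h n) \<subseteq> V" "f = (\<Sum>n<N. h n * mvar v ^ n)"
    using mpol_split_var[OF insert.prems(2)] by blast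
  ultimately show ?case using insert.prems(3) by blast
qed

lemma gen_ring_eq: "gen_ring = carrier (int_valued_ring D I)"
proof (intro equalityI subsetI)
  fix f assume "f \<in> carrier (int_valued_ring D I)"
  then have f: "mvars f \<subseteq> I" "\<And>x. x \<in> I \<rightarrow> D \<Longrightarrow> meval x f \<in> D"
    by (simp_all add: carrier_int_valued_ring)
  \<comment> \<open>Although \<open>I\<close> may be infinite, each polynomial involves only
    finitely many variables.\<close>
  have "finite (mvars f)" by (simp add: mvars_def)
  then show "f \<in> gen_ring" by (rule int_valued_in_gen_ring[OF _ f(1) order_refl f(2)])
qed (use msubst_int_valued in blast)

end

theorem theorem5p5:
  fixes D :: "'k::field set" and \<pi> :: "nat \<Rightarrow> 'k" and I :: "'i set"
  assumes "class_C D"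
    and "\<And>q. primepow q \<Longrightarrow> \<pi> q \<in> D \<and> Pi_ideal D q = Idl\<^bsub>ring_on D\<^esub> {\<pi> q}"
  defines "A \<equiv> mpol_ring D (gen_vars I)"
    and "B \<equiv> int_valued_ring D I"
  defines "is_canonical \<equiv> \<lambda>\<phi>. D_algebra_hom D A B \<phi> \<and>
      (\<forall>i\<in>I. \<phi> (mvar (Base i)) = mvar i) \<and>
      (\<forall>i\<in>I. \<forall>q k. primepow q \<longrightarrow>
         \<phi> (mvar (Iter i q k)) = poly_at_var (poly_iterate k (F_poly \<pi> q)) i)"
  shows "(\<forall>q. primepow q \<longrightarrow> F_poly \<pi> q \<in> int_valued D) \<and>
    (\<exists>\<phi>. is_canonical \<phi> \<and>
         (\<forall>\<psi>. is_canonical \<psi> \<longrightarrow> (\<forall>f\<in>carrier A. \<psi> f = \<phi> f)) \<and>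
         \<phi> ` carrier A = carrier B \<and>
         a_kernel A B \<phi> = Idl\<^bsub>A\<^esub> (relators \<pi> I))"
proof -
  interpret P: presentation D \<pi> I
    using assms(1,2) by unfold_locales
  have ops: "\<one>\<^bsub>A\<^esub> = 1" "x \<otimes>\<^bsub>A\<^esub> y = x * y" "x \<oplus>\<^bsub>A\<^esub> y = x + y"
    "\<one>\<^bsub>B\<^esub> = 1" "\<zero>\<^bsub>B\<^esub> = 0" "x' \<otimes>\<^bsub>B\<^esub> y' = x' * y'" "x' \<oplus>\<^bsub>B\<^esub> y' = x' + y'" for x y x' y'
    by (simp_all add: A_def B_def mpol_ring_def int_valued_ring_def)
  have hom: "P.\<phi> \<in> ring_hom A B"
    by (rule ring_hom_memI)
      (simp_all add: ops msubst_mult msubst_add, simp add: A_def B_def P.msubst_int_valued)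
  have canonical: "is_canonical P.\<phi>"
    unfolding is_canonical_def D_algebra_hom_def using hom by (simp add: P.gen_image_def)
  moreover have "\<psi> f = P.\<phi> f" if \<psi>: "is_canonical \<psi>" and f: "f \<in> carrier A" for \<psi> f
  proof -
    have hom': "\<psi> \<in> ring_hom A B" using \<psi> by (simp add: is_canonical_def D_algebra_hom_def)
    have \<psi>_var: "\<psi> (mvar v) = P.\<phi> (mvar v)" if "v \<in> gen_vars I" for v
      using that \<psi> by (auto simp: gen_vars_def P.gen_image_def is_canonical_def)
    \<comment> \<open>Membership in the carrier is carried through the induction because the
      homomorphism laws of \<open>\<psi>\<close> hold only there.\<close>
    from f P.zero_closed have "f \<in> carrier A \<and> \<psi> f = P.\<phi> f"
      unfolding A_def
    proof (induction f rule: mpol_ring_induct)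
      case (const d)
      then show ?case
        using \<psi> P.mconst_in_A by (simp add: is_canonical_def D_algebra_hom_def)
    next
      case (var v f)
      have mem: "mvar v \<in> carrier A" "f \<in> carrier A"
        using var mvar_in_mpol_ring[OF var(1) P.zero_closed P.one_closed] by (simp_all add: A_def)
      have "\<psi> (mvar v * f) = \<psi> (mvar v) * \<psi> f"
        using ring_hom_mult[OF hom' mem] unfolding ops .
      then show ?case
        using var(2) mem P.A.mult_closed[of "mvar v" f] \<psi>_var[OF var(1)]
        by (simp add: msubst_mult A_def)
    next
      case (add f g)
      have mem: "f \<in> carrier A" "g \<in> carrier A" using add by (simp_all add: A_def)
      have "\<psi> (f + g) = \<psi> f + \<psi> g"
        using ring_hom_add[OF hom' mem] unfolding ops .
      then show ?case using add by (simp add: msubst_add P.A.add_closed)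
    qed
    then show ?thesis by blast
  qed
  moreover have "P.\<phi> ` carrier A = carrier B"
    unfolding A_def B_def by (rule P.gen_ring_eq)
  moreover have "a_kernel A B P.\<phi> = Idl\<^bsub>A\<^esub> (relators \<pi> I)"
    unfolding a_kernel_def' ops A_def
    using P.kernel_subset_J P.msubst_J P.J_subset by blast
  ultimately show ?thesis using P.F_poly_int_valued by blast
qed

end
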